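(* Let $A_1,\dots,A_n$ be complex vector spaces of dimension at least $2$ and let $X=\mathrm{Seg}(\mathbb P A_1\times\cdots\times\mathbb P A_n)\subset\mathbb P(A_1\otimes\cdots\otimes A_n)$ be the Segre variety. Every nonzero $x\in\hat\sigma_2(X)$ has one of the following normal forms, where all $a^j_1,a^j_2\in A_j$ are nonzero vectors: (a) $x=a_1^1\otimes\cdots\otimes a_1^n$ (so $[x]\in X$), which has rank $1$; (b) $x=a_1^1\otimes\cdots\otimes a_1^n+a_2^1\otimes\cdots\otimes a_2^n$, where for at least two indices $i$ the vector $a_2^i$ is linearly independent of $a_1^i$ (a point on a secant line to $X$), which has rank $2$; (c) for a subset $J\subseteq\{1,\dots,n\}$ with $|J|>2$, $$x=\sum_{j\in J}a_1^1\otimes\cdots\otimes a_1^{j-1}\otimes a_2^{j}\otimes a_1^{j+1}\otimes\cdots\otimes a_1^n,$$ where for each $j\in J$ the vector $a_2^j$ is linearly independent of $a_1^j$; such an $x$ has rank $|J|$. In particular, all ranks from $1$ to $n$ occur for elements of $\sigma_2(X)$.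
   Context: The ground field is $\mathbb C$. The Segre variety $\mathrm{Seg}(\mathbb P A_1\times\cdots\times\mathbb P A_n)$ is the set of classes of decomposable tensors $[a^1\otimes\cdots\otimes a^n]$. For a projective variety $X\subset\mathbb P V$ not contained in a hyperplane, $\sigma_2(X)\subset\mathbb P V$ is the secant variety: the set of points lying in a limiting space $\lim_{t\to0}\langle x_1(t),x_2(t)\rangle$ with $x_1(t),x_2(t)$ curves in $X$. For $Z\subset\mathbb P V$, $\hat Z\subset V$ denotes the affine cone over $Z$. The rank of a nonzero tensor $x$ is the smallest $r$ such that $x$ is a sum of $r$ decomposable tensors. *)

theory Defs
  imports "HOL-Analysis.Analysis" "HOL-Library.Function_Algebras"
begin

subsection \<open>Projective geometry in a space of complex-valued functions\<close>

text \<open>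
  The ambient vector space \<open>V\<close> below is always a finite-dimensional subspace of a space
  \<open>'i \<Rightarrow> complex\<close>, with pointwise operations.  Its topology is the one induced by pointwise
  convergence; this is the unique Hausdorff vector space topology of \<open>V\<close>.
\<close>

definition cscale :: "complex \<Rightarrow> ('i \<Rightarrow> complex) \<Rightarrow> 'i \<Rightarrow> complex" where
  "cscale c f = (\<lambda>i. c * f i)"

interpretation fct: vector_space "cscale :: complex \<Rightarrow> ('i \<Rightarrow> complex) \<Rightarrow> 'i \<Rightarrow> complex"
  by unfold_locales (auto simp: cscale_def fun_eq_iff algebra_simps)

text \<open>The point \<open>[v]\<close> of the projective space is the line spanned by \<open>v\<close>.\<close>

definition proj_space :: "('i \<Rightarrow> complex) set \<Rightarrow> ('i \<Rightarrow> complex) set set" where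
  "proj_space V = {fct.span {v} | v. v \<in> V \<and> v \<noteq> 0}"

definition affine_cone :: "('i \<Rightarrow> complex) set set \<Rightarrow> ('i \<Rightarrow> complex) set" where
  "affine_cone Z = {v. v = 0 \<or> fct.span {v} \<in> Z}"

text \<open>
  A curve in \<open>X\<close> is a germ at \<open>t = 0\<close> of a holomorphic arc, given near \<open>0\<close> by a nowhere vanishing
  holomorphic lift to the affine cone.  Only the values of \<open>x\<close> near \<open>0\<close> matter.
\<close>

definition curve_in :: "('i \<Rightarrow> complex) set set \<Rightarrow> (complex \<Rightarrow> ('i \<Rightarrow> complex) set) \<Rightarrow> bool" where
  "curve_in X x \<longleftrightarrow> (\<exists>\<epsilon>>0. \<exists>y.
     (\<forall>t\<in>ball 0 \<epsilon>. x t \<in> X \<and> y t \<noteq> 0 \<and> x t = fct.span {y t}) \<and>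
     (\<forall>i. (\<lambda>t. y t i) holomorphic_on ball 0 \<epsilon>))"

text \<open>
  Convergence of planes in the Grassmannian \<open>G(2,V)\<close>, whose topology is the quotient of the topology
  of the space of \<open>2\<close>-frames: suitable bases of \<open>E t\<close> converge to a basis of \<open>L\<close>.
\<close>

definition plane_tendsto ::
  "(complex \<Rightarrow> ('i \<Rightarrow> complex) set) \<Rightarrow> ('i \<Rightarrow> complex) set \<Rightarrow> complex filter \<Rightarrow> bool" where
  "plane_tendsto E L F \<longleftrightarrow> (\<exists>u w u0 w0.
     (\<forall>\<^sub>F t in F. E t = fct.span {u t, w t}) \<and> (u \<longlongrightarrow> u0) F \<and> (w \<longlongrightarrow> w0) F \<and>
     L = fct.span {u0, w0} \<and> fct.dim L = 2)"

definition secant_variety :: "('i \<Rightarrow> complex) set \<Rightarrow> ('i \<Rightarrow> complex) set set \<Rightarrow> ('i \<Rightarrow> complex) set set" where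
  "secant_variety V X = {p \<in> proj_space V. \<exists>x1 x2 L. curve_in X x1 \<and> curve_in X x2 \<and>
     plane_tendsto (\<lambda>t. fct.span (x1 t \<union> x2 t)) L (at 0) \<and> p \<subseteq> L}"

definition on_secant_line :: "('i \<Rightarrow> complex) set set \<Rightarrow> ('i \<Rightarrow> complex) set \<Rightarrow> bool" where
  "on_secant_line X p \<longleftrightarrow> (\<exists>q1\<in>X. \<exists>q2\<in>X. q1 \<noteq> q2 \<and> p \<subseteq> fct.span (q1 \<union> q2))"

subsection \<open>Tensors and the Segre variety\<close>

text \<open>
  The factors \<open>A j\<close> (\<open>1 \<le> j \<le> n\<close>) are finite-dimensional subspaces of an arbitrary complex vector
  space with scalar multiplication \<open>s\<close>, which allows them to have different dimensions.
  As usual in finite dimensions, the tensor \<open>a 1 \<otimes> \<dots> \<otimes> a n\<close> is the multilinear function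
  \<open>(\<beta> 1, \<dots>, \<beta> n) \<mapsto> \<beta> 1 (a 1) * \<dots> * \<beta> n (a n)\<close> on the product of the dual spaces of the \<open>A j\<close>
  (extended by \<open>0\<close> to other arguments), and \<open>A 1 \<otimes> \<dots> \<otimes> A n\<close> is the span of these functions.
\<close>

type_synonym 'v tensor = "(nat \<Rightarrow> 'v \<Rightarrow> complex) \<Rightarrow> complex"

definition dual_space :: "(complex \<Rightarrow> 'v \<Rightarrow> 'v) \<Rightarrow> 'v::ab_group_add set \<Rightarrow> ('v \<Rightarrow> complex) set" where
  "dual_space s A = {\<beta>. (\<forall>v\<in>A. \<forall>w\<in>A. \<beta> (v + w) = \<beta> v + \<beta> w) \<and> (\<forall>c. \<forall>v\<in>A. \<beta> (s c v) = c * \<beta> v)}"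

definition tensor ::
  "(complex \<Rightarrow> 'v \<Rightarrow> 'v) \<Rightarrow> (nat \<Rightarrow> 'v::ab_group_add set) \<Rightarrow> nat \<Rightarrow> (nat \<Rightarrow> 'v) \<Rightarrow> 'v tensor" where
  "tensor s A n a = (\<lambda>\<beta>. if \<forall>j\<in>{1..n}. \<beta> j \<in> dual_space s (A j) then \<Prod>j=1..n. \<beta> j (a j) else 0)"

definition decomposable ::
  "(complex \<Rightarrow> 'v \<Rightarrow> 'v) \<Rightarrow> (nat \<Rightarrow> 'v::ab_group_add set) \<Rightarrow> nat \<Rightarrow> 'v tensor set" where
  "decomposable s A n = {tensor s A n a | a. \<forall>j\<in>{1..n}. a j \<in> A j}"

definition tensor_space ::
  "(complex \<Rightarrow> 'v \<Rightarrow> 'v) \<Rightarrow> (nat \<Rightarrow> 'v::ab_group_add set) \<Rightarrow> nat \<Rightarrow> 'v tensor set" where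
  "tensor_space s A n = fct.span (decomposable s A n)"

definition segre ::
  "(complex \<Rightarrow> 'v \<Rightarrow> 'v) \<Rightarrow> (nat \<Rightarrow> 'v::ab_group_add set) \<Rightarrow> nat \<Rightarrow> 'v tensor set set" where
  "segre s A n = {fct.span {tensor s A n a} | a. \<forall>j\<in>{1..n}. a j \<in> A j \<and> a j \<noteq> 0}"

definition tensor_rank ::
  "(complex \<Rightarrow> 'v \<Rightarrow> 'v) \<Rightarrow> (nat \<Rightarrow> 'v::ab_group_add set) \<Rightarrow> nat \<Rightarrow> 'v tensor \<Rightarrow> nat" where
  "tensor_rank s A n x =
     (LEAST r. \<exists>f::nat \<Rightarrow> 'v tensor. (\<forall>k<r. f k \<in> decomposable s A n) \<and> x = (\<Sum>k<r. f k))"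

subsection \<open>Normal forms\<close>

definition normal_form_a ::
  "(complex \<Rightarrow> 'v \<Rightarrow> 'v) \<Rightarrow> (nat \<Rightarrow> 'v::ab_group_add set) \<Rightarrow> nat \<Rightarrow> 'v tensor \<Rightarrow> bool" where
  "normal_form_a s A n x \<longleftrightarrow>
     (\<exists>a1. (\<forall>j\<in>{1..n}. a1 j \<in> A j \<and> a1 j \<noteq> 0) \<and> x = tensor s A n a1)"

definition normal_form_b ::
  "(complex \<Rightarrow> 'v \<Rightarrow> 'v) \<Rightarrow> (nat \<Rightarrow> 'v::ab_group_add set) \<Rightarrow> nat \<Rightarrow> 'v tensor \<Rightarrow> bool" where
  "normal_form_b s A n x \<longleftrightarrow>
     (\<exists>a1 a2. (\<forall>j\<in>{1..n}. a1 j \<in> A j \<and> a1 j \<noteq> 0 \<and> a2 j \<in> A j \<and> a2 j \<noteq> 0) \<and>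
        card {i\<in>{1..n}. a2 i \<notin> module.span s {a1 i}} \<ge> 2 \<and>
        x = tensor s A n a1 + tensor s A n a2)"

definition normal_form_c ::
  "(complex \<Rightarrow> 'v \<Rightarrow> 'v) \<Rightarrow> (nat \<Rightarrow> 'v::ab_group_add set) \<Rightarrow> nat \<Rightarrow> nat set \<Rightarrow> 'v tensor \<Rightarrow> bool" where
  "normal_form_c s A n J x \<longleftrightarrow> J \<subseteq> {1..n} \<and> card J > 2 \<and>
     (\<exists>a1 a2. (\<forall>j\<in>{1..n}. a1 j \<in> A j \<and> a1 j \<noteq> 0 \<and> a2 j \<in> A j \<and> a2 j \<noteq> 0) \<and>
        (\<forall>j\<in>J. a2 j \<notin> module.span s {a1 j}) \<and>
        x = (\<Sum>j\<in>J. tensor s A n (a1(j := a2 j))))"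

end

theory Submission
  imports Defs
begin

text \<open>
  A point of the cone is a limit of \<open>l(t) a(t) + m(t) b(t)\<close> with \<open>a(t)\<close>, \<open>b(t)\<close> decomposable.  After
  rescaling, the factors of \<open>a(t)\<close> and \<open>b(t)\<close> accumulate at nonzero vectors.  If the limits of \<open>a(t)\<close>
  and \<open>b(t)\<close> are not proportional, then \<open>l\<close> and \<open>m\<close> converge by Cramer's rule and the limit is a sum
  of two decomposable tensors.  Otherwise normalise the factors by functionals that are \<open>1\<close> on the
  common limit \<open>e\<close>; evaluating all but one slot at these functionals shows that \<open>l + m\<close> and
  \<open>m (b\<^sub>j(t) - a\<^sub>j(t))\<close> converge, and telescoping \<open>b(t) - a(t)\<close> gives a tangent vector at \<open>e\<close>.

  For the lower bound on the rank of \<open>\<Sum>j\<in>J. e\<^sub>1 \<otimes> \<dots> \<otimes> f\<^sub>j \<otimes> \<dots> \<otimes> e\<^sub>n\<close>, contract one slot of \<open>J\<close> with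
  a functional that kills one of the decomposable summands but not \<open>e\<^sub>j\<close>: this removes a summand and
  leaves a tensor of the same shape for the remaining slots, up to a multiple of \<open>e\<close>.
\<close>

section \<open>Functionals on the factors and decomposable tensors\<close>

lemma dual_space_add: "\<beta> \<in> dual_space s V \<Longrightarrow> v \<in> V \<Longrightarrow> w \<in> V \<Longrightarrow> \<beta> (v + w) = \<beta> v + \<beta> w"
  and dual_space_scale: "\<beta> \<in> dual_space s V \<Longrightarrow> v \<in> V \<Longrightarrow> \<beta> (s c v) = c * \<beta> v"
  unfolding dual_space_def by auto

lemma dual_space_lincomb:
  "\<beta> \<in> dual_space s V \<Longrightarrow> \<gamma> \<in> dual_space s V \<Longrightarrow> (\<lambda>v. p * \<beta> v + q * \<gamma> v) \<in> dual_space s V"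
  unfolding dual_space_def by (auto simp: algebra_simps)

lemma sum_fun_apply: "(\<Sum>k\<in>K. f k) x = (\<Sum>k\<in>K. f k x)" for f :: "'a \<Rightarrow> 'b \<Rightarrow> 'c::comm_monoid_add"
  by (induction K rule: infinite_finite_induct) auto

locale tensor_factors = vector_space s
  for s :: "complex \<Rightarrow> 'v::ab_group_add \<Rightarrow> 'v" +
  fixes A :: "nat \<Rightarrow> 'v set" and n :: nat
  assumes n_ge_1: "n \<ge> 1"
    and subspace_A: "j \<in> {1..n} \<Longrightarrow> subspace (A j)"
    and finitely_spanned_A: "j \<in> {1..n} \<Longrightarrow> \<exists>B. finite B \<and> A j = span B"
begin

abbreviation T :: "(nat \<Rightarrow> 'v) \<Rightarrow> 'v tensor" where "T \<equiv> tensor s A n"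

definition families :: "(nat \<Rightarrow> 'v) set" where
  "families = {a. \<forall>j\<in>{1..n}. a j \<in> A j}"

definition nonzero_families :: "(nat \<Rightarrow> 'v) set" where
  "nonzero_families = {a. \<forall>j\<in>{1..n}. a j \<in> A j \<and> a j \<noteq> 0}"

definition dual_families :: "(nat \<Rightarrow> 'v \<Rightarrow> complex) set" where
  "dual_families = {\<beta>. \<forall>j\<in>{1..n}. \<beta> j \<in> dual_space s (A j)}"

lemma nonzero_families_subset: "a \<in> nonzero_families \<Longrightarrow> a \<in> families"
  unfolding nonzero_families_def families_def by auto

lemma A_add: "j \<in> {1..n} \<Longrightarrow> v \<in> A j \<Longrightarrow> w \<in> A j \<Longrightarrow> v + w \<in> A j"
  and A_diff: "j \<in> {1..n} \<Longrightarrow> v \<in> A j \<Longrightarrow> w \<in> A j \<Longrightarrow> v - w \<in> A j"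
  and A_scale: "j \<in> {1..n} \<Longrightarrow> v \<in> A j \<Longrightarrow> s c v \<in> A j"
  and A_zero: "j \<in> {1..n} \<Longrightarrow> 0 \<in> A j"
  using subspace_A subspace_add subspace_diff subspace_scale subspace_0 by blast+

lemma tensor_apply: "\<beta> \<in> dual_families \<Longrightarrow> T a \<beta> = (\<Prod>j=1..n. \<beta> j (a j))"
  and tensor_outside: "\<beta> \<notin> dual_families \<Longrightarrow> T a \<beta> = 0"
  unfolding tensor_def dual_families_def by auto

lemma tensor_eqI: "(\<And>\<beta>. \<beta> \<in> dual_families \<Longrightarrow> f \<beta> = g \<beta>) \<Longrightarrow>
   (\<And>\<beta>. \<beta> \<notin> dual_families \<Longrightarrow> f \<beta> = g \<beta>) \<Longrightarrow> f = (g :: 'v tensor)"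
  by blast

lemma tensor_apply_slot:
  assumes "\<beta> \<in> dual_families" "j \<in> {1..n}"
  shows "T a \<beta> = \<beta> j (a j) * (\<Prod>i\<in>{1..n}-{j}. \<beta> i (a i))"
  using assms by (simp add: tensor_apply prod.remove)

lemma tensor_apply_upd:
  assumes "\<beta> \<in> dual_families" "j \<in> {1..n}"
  shows "T (a(j := v)) \<beta> = \<beta> j v * (\<Prod>i\<in>{1..n}-{j}. \<beta> i (a i))"
  by (subst tensor_apply_slot[OF assms]) (auto intro: prod.cong)

lemma dual_familiesD: "\<beta> \<in> dual_families \<Longrightarrow> j \<in> {1..n} \<Longrightarrow> \<beta> j \<in> dual_space s (A j)"
  unfolding dual_families_def by auto

lemma tensor_upd_add:
  assumes "j \<in> {1..n}" "v \<in> A j" "w \<in> A j"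
  shows "T (a(j := v + w)) = T (a(j := v)) + T (a(j := w))"
  using assms by (intro tensor_eqI)
    (auto simp: tensor_apply_upd tensor_outside algebra_simps dual_space_add[OF dual_familiesD])

lemma tensor_upd_scale:
  assumes "j \<in> {1..n}" "v \<in> A j"
  shows "T (a(j := s c v)) = cscale c (T (a(j := v)))"
  using assms by (intro tensor_eqI)
    (auto simp: cscale_def tensor_apply_upd tensor_outside algebra_simps dual_space_scale[OF dual_familiesD])

lemma tensor_cong: "(\<And>j. j \<in> {1..n} \<Longrightarrow> a j = b j) \<Longrightarrow> T a = T b"
  unfolding tensor_def by (auto simp: fun_eq_iff)

lemma tensor_eq_0: "j \<in> {1..n} \<Longrightarrow> a j = 0 \<Longrightarrow> T a = 0"
  using tensor_upd_scale[where j=j and v=0 and c=0 and a=a] A_zero[of j] fun_upd_triv[of a j]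
  by (simp add: cscale_def zero_fun_def)

lemma tensor_scale_all:
  assumes "a \<in> families"
  shows "T (\<lambda>j. s (c j) (a j)) = cscale (\<Prod>j=1..n. c j) (T a)"
  using assms by (intro tensor_eqI)
    (auto simp: cscale_def tensor_apply tensor_outside families_def dual_space_scale[OF dual_familiesD]
       simp flip: prod.distrib intro!: prod.cong)

text \<open>The functional is built linear on the whole ambient space, hence it lies in the dual
  space of every \<open>V\<close>.\<close>

lemma functional_extension:
  assumes "independent S"
  shows "\<exists>\<beta>\<in>dual_space s V. \<forall>b\<in>S. \<beta> b = f b"
proof -
  interpret cv: vector_space "(*) :: complex \<Rightarrow> complex \<Rightarrow> complex"
    by unfold_locales (auto simp: algebra_simps)
  interpret vector_space_pair s "(*) :: complex \<Rightarrow> complex \<Rightarrow> complex" ..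
  obtain g where "Vector_Spaces.linear s (*) g" and g: "\<forall>x\<in>S. g x = f x"
    using linear_independent_extend[OF assms] by blast
  then have "g \<in> dual_space s V"
    by (auto simp: dual_space_def Vector_Spaces.linear_iff)
  with g show ?thesis by blast
qed

lemma functional_on_vector:
  assumes "u \<noteq> 0"
  obtains \<beta> where "\<beta> \<in> dual_space s V" "\<beta> u = 1"
  using functional_extension[of "{u}" V "\<lambda>_. 1"] assms by auto

lemma independent_pair: "u \<noteq> 0 \<Longrightarrow> v \<notin> span {u} \<Longrightarrow> independent {v, u}"
  by (simp add: independent_insert)

lemma functional_on_pair:
  assumes "u \<noteq> 0" "v \<notin> span {u}"
  obtains \<beta> where "\<beta> \<in> dual_space s V" "\<beta> u = p" "\<beta> v = q"
proof -
  have "u \<noteq> v" using assms(2) span_base[of v "{v}"] by auto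
  then show ?thesis
    using functional_extension[OF independent_pair[OF assms], of V "\<lambda>x. if x = u then p else q"] that
    by auto
qed

text \<open>If \<open>v\<close> lies on the line of \<open>u\<close>, it is a nonzero multiple of
  \<open>u\<close>, and a functional with value 1 at \<open>u\<close> works; otherwise both values
  can be prescribed. Such functionals contract slots without losing either of two tensors.\<close>

lemma functional_nonzero_on_two:
  assumes "u \<in> V" "v \<in> V" "u \<noteq> 0" "v \<noteq> 0"
  obtains \<beta> where "\<beta> \<in> dual_space s V" "\<beta> u \<noteq> 0" "\<beta> v \<noteq> 0"
proof (cases "v \<in> span {u}")
  case True
  then obtain c where v: "v = s c u" by (auto simp: span_singleton)
  obtain \<beta> where "\<beta> \<in> dual_space s V" "\<beta> u = 1"
    using functional_on_vector[OF assms(3)] .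
  with assms v show ?thesis by (intro that[of \<beta>]) (auto simp: dual_space_scale)
next
  case False
  show ?thesis
    by (rule functional_on_pair[OF assms(3) False, of V 1 1]) (use that in auto)
qed

lemma tensor_nonzero:
  assumes "a \<in> nonzero_families"
  shows "T a \<noteq> 0"
proof -
  have "\<forall>j. \<exists>\<beta>. j \<in> {1..n} \<longrightarrow> \<beta> \<in> dual_space s (A j) \<and> \<beta> (a j) = 1"
    using assms functional_on_vector unfolding nonzero_families_def by blast
  then obtain \<beta> where \<beta>: "\<forall>j. j \<in> {1..n} \<longrightarrow> \<beta> j \<in> dual_space s (A j) \<and> \<beta> j (a j) = 1"
    by metis
  then have "T a \<beta> = 1"
    by (subst tensor_apply) (auto simp: dual_families_def)
  then show ?thesis by auto
qed

lemma tensor_in_decomposable: "a \<in> families \<Longrightarrow> T a \<in> decomposable s A n"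
  unfolding families_def decomposable_def by auto

lemma decomposable_eq: "decomposable s A n = T ` families"
  unfolding families_def decomposable_def by auto

lemma segre_eq: "segre s A n = (\<lambda>a. fct.span {T a}) ` nonzero_families"
  unfolding nonzero_families_def segre_def by auto

lemma normal_form_a_iff: "normal_form_a s A n x \<longleftrightarrow> (\<exists>a\<in>nonzero_families. x = T a)"
  unfolding normal_form_a_def nonzero_families_def by auto

lemma normal_form_aI:
  assumes "x = T a" "x \<noteq> 0" "a \<in> families"
  shows "normal_form_a s A n x"
proof -
  have "a \<in> nonzero_families"
    using assms tensor_eq_0 unfolding nonzero_families_def families_def by blast
  with assms(1) show ?thesis by (auto simp: normal_form_a_iff)
qed

section \<open>Bounds on the tensor rank and the ranks of the normal forms\<close>

lemma tensor_rank_le: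
  assumes "finite K" "\<And>k. k \<in> K \<Longrightarrow> a k \<in> families"
  shows "tensor_rank s A n (\<Sum>k\<in>K. T (a k)) \<le> card K"
proof -
  obtain h where h: "bij_betw h {..<card K} K"
    using ex_bij_betw_nat_finite[OF assms(1)] by (auto simp: atLeast0LessThan)
  have "(\<Sum>k\<in>K. T (a k)) = (\<Sum>k<card K. T (a (h k)))"
    using sum.reindex_bij_betw[OF h, of "\<lambda>k. T (a k)"] by simp
  moreover have "\<forall>k<card K. T (a (h k)) \<in> decomposable s A n"
    using h assms(2) by (auto simp: decomposable_eq bij_betw_def)
  ultimately show ?thesis
    unfolding tensor_rank_def by (intro Least_le exI[of _ "\<lambda>k. T (a (h k))"]) simp
qed

text \<open>A \<open>LEAST\<close> is attained only if some decomposition exists; the family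
  \<open>b\<close> supplies one. The bound on all decompositions then applies to a minimal
  one.\<close>

lemma tensor_rank_ge:
  assumes "x = (\<Sum>k<m::nat. T (b k))" "\<And>k. k < m \<Longrightarrow> b k \<in> families"
    and "\<And>r a. (\<And>k. k < (r::nat) \<Longrightarrow> a k \<in> families) \<Longrightarrow> x = (\<Sum>k<r. T (a k)) \<Longrightarrow> d \<le> r"
  shows "d \<le> tensor_rank s A n x"
proof -
  let ?P = "\<lambda>r. \<exists>f::nat \<Rightarrow> 'v tensor. (\<forall>k<r. f k \<in> decomposable s A n) \<and> x = (\<Sum>k<r. f k)"
  have "?P m" using assms(1,2) by (intro exI[of _ "\<lambda>k. T (b k)"]) (auto simp: decomposable_eq)
  then have "?P (tensor_rank s A n x)"
    unfolding tensor_rank_def by (rule LeastI)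
  then obtain f :: "nat \<Rightarrow> 'v tensor" where
    f: "\<forall>k<tensor_rank s A n x. \<exists>a. a \<in> families \<and> f k = T a"
    and x: "x = (\<Sum>k<tensor_rank s A n x. f k)"
    unfolding decomposable_eq by blast
  then obtain a where a: "\<And>k. k < tensor_rank s A n x \<Longrightarrow> a k \<in> families \<and> f k = T (a k)"
    by metis
  show ?thesis
    by (rule assms(3)[of _ a]) (use a x in auto)
qed

end

text \<open>Coordinate form of the rank bound: \<open>p j\<close> and \<open>q j\<close> are the
  weights of two functionals in slot \<open>j\<close>, whose values on summand \<open>k\<close> are
  \<open>x k j\<close> and \<open>y k j\<close>. The term with \<open>\<nu>\<close> and the
  coefficients \<open>c\<close> and \<open>w\<close> are carried along because contracting a slot
  produces them; each induction step removes one slot and one summand.\<close>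

lemma card_le_of_linear_product_identity:
  fixes c w :: "_ \<Rightarrow> complex" and x y :: "'k \<Rightarrow> 'i \<Rightarrow> complex"
  assumes "finite J" "finite K" "\<And>j. j \<in> J \<Longrightarrow> c j \<noteq> 0"
    and "\<And>p q. \<nu> * (\<Prod>j\<in>J. p j) + (\<Sum>j\<in>J. c j * q j * (\<Prod>i\<in>J-{j}. p i)) =
               (\<Sum>k\<in>K. w k * (\<Prod>j\<in>J. p j * x k j + q j * y k j))"
  shows "card J \<le> card K"
  using assms
proof (induction J arbitrary: \<nu> c w K rule: finite_induct)
  case empty
  then show ?case by simp
next
  case (insert j J)
  define P where "P p = (\<Prod>j\<in>J. p j)" for p :: "'i \<Rightarrow> complex"
  define S where "S p q = (\<Sum>j\<in>J. c j * q j * (\<Prod>i\<in>J-{j}. p i))" for p q :: "'i \<Rightarrow> complex"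
  define M where "M k p q = (\<Prod>j\<in>J. p j * x k j + q j * y k j)" for k and p q :: "'i \<Rightarrow> complex"
  \<comment> \<open>The identity after contracting slot \<open>j\<close> with weights
    \<open>u\<close> and \<open>v\<close>, the other slots staying free.\<close>
  have key: "(\<nu> * u + c j * v) * P p + u * S p q = (\<Sum>k\<in>K. w k * (u * x k j + v * y k j) * M k p q)"
    for u v p q
  proof -
    let ?p = "p(j := u)" and ?q = "q(j := v)"
    have P: "(\<Prod>i\<in>J. ?p i) = P p"
      unfolding P_def using insert.hyps by (intro prod.cong) auto
    have S: "(\<Sum>i\<in>J. c i * ?q i * (\<Prod>l\<in>insert j J-{i}. ?p l)) = u * S p q"
      unfolding S_def sum_distrib_left
    proof (rule sum.cong)
      fix i assume i: "i \<in> J"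
      then have "insert j J - {i} = insert j (J - {i})" using insert.hyps by auto
      moreover have "(\<Prod>l\<in>J-{i}. ?p l) = (\<Prod>l\<in>J-{i}. p l)"
        using insert.hyps by (intro prod.cong) auto
      ultimately have "(\<Prod>l\<in>insert j J-{i}. ?p l) = u * (\<Prod>l\<in>J-{i}. p l)"
        using insert.hyps by simp
      with i insert.hyps show "c i * ?q i * (\<Prod>l\<in>insert j J-{i}. ?p l) = u * (c i * q i * (\<Prod>l\<in>J-{i}. p l))"
        by (auto simp: ac_simps)
    qed simp
    have M: "(\<Prod>i\<in>J. ?p i * x k i + ?q i * y k i) = M k p q" for k
      unfolding M_def using insert.hyps by (intro prod.cong) auto
    have j: "insert j J - {j} = J" using insert.hyps by auto
    show ?thesis
      using insert.prems(3)[of ?p ?q] insert.hyps P S M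
      by (simp add: j algebra_simps)
  qed
  \<comment> \<open>At \<open>u = 0\<close>, \<open>v = 1\<close>, \<open>p = 1\<close>,
    \<open>q = 0\<close> the left side is \<open>c j\<close>, which is nonzero, so some summand has
    \<open>y k j \<noteq> 0\<close>.\<close>
  have "(\<Sum>k\<in>K. w k * y k j * M k (\<lambda>_. 1) (\<lambda>_. 0)) \<noteq> 0"
    using key[of 0 1 "\<lambda>_. 1" "\<lambda>_. 0"] insert.prems(2)[of j] by (auto simp: P_def)
  then obtain k where k: "k \<in> K" "y k j \<noteq> 0"
    by (metis (no_types, lifting) mult_zero_left mult_zero_right sum.neutral)
  \<comment> \<open>The weights \<open>u = y k j\<close> and \<open>v = - x k j\<close> annihilate
    summand \<open>k\<close>, while the linear terms get the coefficients
    \<open>y k j * c i\<close>, which are still nonzero.\<close>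
  have "card J \<le> card (K - {k})"
  proof (rule insert.IH[of "K - {k}" "\<lambda>i. y k j * c i" "\<nu> * y k j - c j * x k j"
        "\<lambda>i. w i * (y k j * x i j - x k j * y i j)"])
    fix p q
    show "(\<nu> * y k j - c j * x k j) * prod p J + (\<Sum>i\<in>J. y k j * c i * q i * prod p (J - {i})) =
      (\<Sum>i\<in>K - {k}. w i * (y k j * x i j - x k j * y i j) * (\<Prod>j\<in>J. p j * x i j + q j * y i j))"
      using key[of "y k j" "- x k j" p q] k(1) insert.prems(1)
      by (simp add: P_def M_def S_def sum_distrib_left mult.assoc sum.remove)
  qed (use insert k in auto)
  moreover have "card K > 0" using k insert.prems(1) by (auto simp: card_gt_0_iff)
  ultimately show ?case using insert.hyps insert.prems(1) k by (simp add: card_Diff_singleton)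
qed

context tensor_factors
begin

text \<open>Evaluation at functionals built from pairs dual to \<open>a j\<close>,
  \<open>f j\<close> in the slots of \<open>J\<close> turns the tensor equation into the hypothesis
  of \<open>card_le_of_linear_product_identity\<close>, with \<open>\<nu> = 0\<close> and every
  \<open>c j = 1\<close>.\<close>

lemma tangent_sum_rank_ge:
  assumes a: "a \<in> nonzero_families" and J: "J \<subseteq> {1..n}"
    and ind: "\<And>j. j \<in> J \<Longrightarrow> f j \<notin> span {a j}"
    and d: "\<And>k. k < (r::nat) \<Longrightarrow> d k \<in> families"
    and eq: "(\<Sum>j\<in>J. T (a(j := f j))) = (\<Sum>k<r. T (d k))"
    and f: "\<And>j. j \<in> J \<Longrightarrow> f j \<in> A j"
  shows "card J \<le> r"
proof -
  have "\<exists>\<phi> \<psi>. \<phi> \<in> dual_space s (A j) \<and> \<psi> \<in> dual_space s (A j) \<and> \<phi> (a j) = 1 \<and>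
      (j \<in> J \<longrightarrow> \<phi> (f j) = 0 \<and> \<psi> (a j) = 0 \<and> \<psi> (f j) = 1)" if "j \<in> {1..n}" for j
  proof (cases "j \<in> J")
    case True
    then have "a j \<noteq> 0" using that a by (auto simp: nonzero_families_def)
    with ind[OF True] functional_on_pair[of "a j" "f j" "A j"] True show ?thesis by metis
  next
    case False
    have "a j \<noteq> 0" using that a by (auto simp: nonzero_families_def)
    with False functional_on_vector[of "a j" "A j"] show ?thesis by metis
  qed
  then have "\<forall>j\<in>{1..n}. \<exists>\<phi> \<psi>. \<phi> \<in> dual_space s (A j) \<and> \<psi> \<in> dual_space s (A j) \<and> \<phi> (a j) = 1 \<and>
      (j \<in> J \<longrightarrow> \<phi> (f j) = 0 \<and> \<psi> (a j) = 0 \<and> \<psi> (f j) = 1)"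
    by blast
  from bchoice[OF this] obtain \<phi> where "\<forall>j\<in>{1..n}. \<exists>\<psi>. \<phi> j \<in> dual_space s (A j) \<and> \<psi> \<in> dual_space s (A j) \<and>
      \<phi> j (a j) = 1 \<and> (j \<in> J \<longrightarrow> \<phi> j (f j) = 0 \<and> \<psi> (a j) = 0 \<and> \<psi> (f j) = 1)"
    by blast
  from bchoice[OF this] obtain \<psi> where "\<forall>j\<in>{1..n}. \<phi> j \<in> dual_space s (A j) \<and> \<psi> j \<in> dual_space s (A j) \<and>
      \<phi> j (a j) = 1 \<and> (j \<in> J \<longrightarrow> \<phi> j (f j) = 0 \<and> \<psi> j (a j) = 0 \<and> \<psi> j (f j) = 1)"
    by blast
  then have \<phi>: "\<And>j. j \<in> {1..n} \<Longrightarrow> \<phi> j \<in> dual_space s (A j)"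
    and \<psi>: "\<And>j. j \<in> {1..n} \<Longrightarrow> \<psi> j \<in> dual_space s (A j)"
    and 1: "\<And>j. j \<in> {1..n} \<Longrightarrow> \<phi> j (a j) = 1"
    and 2: "\<And>j. j \<in> J \<Longrightarrow> \<phi> j (f j) = 0 \<and> \<psi> j (a j) = 0 \<and> \<psi> j (f j) = 1"
    using J by auto
  \<comment> \<open>In a slot of \<open>J\<close> this functional has value \<open>p j\<close> on
    \<open>a j\<close> and \<open>q j\<close> on \<open>f j\<close>; the other slots are frozen at
    \<open>\<phi> j\<close>, which is 1 on \<open>a j\<close>.\<close>
  define \<beta> where "\<beta> p q j = (if j \<in> J then (\<lambda>v. p j * \<phi> j v + q j * \<psi> j v) else \<phi> j)"
    for p q :: "nat \<Rightarrow> complex" and j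
  have \<beta>: "\<beta> p q \<in> dual_families" for p q
    using \<phi> \<psi> by (auto simp: dual_families_def \<beta>_def intro: dual_space_lincomb)
  have fin: "finite J" using J finite_subset by blast
  have split: "(\<Prod>i=1..n. g i) = (\<Prod>i\<in>{1..n}-J. g i) * (\<Prod>i\<in>J. g i)" for g :: "nat \<Rightarrow> complex"
    using J by (intro prod.subset_diff) auto
  have lhs: "T (a(j := f j)) (\<beta> p q) = 1 * q j * (\<Prod>i\<in>J-{j}. p i)" if "j \<in> J" for j p q
  proof -
    have "(\<Prod>i\<in>{1..n}-J. \<beta> p q i ((a(j := f j)) i)) = 1"
      using that 1 by (intro prod.neutral) (auto simp: \<beta>_def)
    moreover have "(\<Prod>i\<in>J. \<beta> p q i ((a(j := f j)) i)) = q j * (\<Prod>i\<in>J-{j}. p i)"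
    proof -
      have "(\<Prod>i\<in>J-{j}. \<beta> p q i ((a(j := f j)) i)) = (\<Prod>i\<in>J-{j}. p i)"
        using 1 2 J by (intro prod.cong) (auto simp: \<beta>_def)
      then show ?thesis
        using that fin 2 by (simp add: prod.remove[of J j]) (simp add: \<beta>_def)
    qed
    ultimately show ?thesis unfolding tensor_apply[OF \<beta>] split by simp
  qed
  have rhs: "T (d k) (\<beta> p q) = (\<Prod>i\<in>{1..n}-J. \<phi> i (d k i)) * (\<Prod>j\<in>J. p j * \<phi> j (d k j) + q j * \<psi> j (d k j))"
    for k p q
    unfolding tensor_apply[OF \<beta>] split
    by (intro arg_cong2[where f="(*)"] prod.cong) (auto simp: \<beta>_def)
  have "card J \<le> card {..<r}"
  proof (rule card_le_of_linear_product_identity[of J "{..<r}" "\<lambda>_. 1" 0 _ "\<lambda>k j. \<phi> j (d k j)" "\<lambda>k j. \<psi> j (d k j)"])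
    fix p q
    have "(\<Sum>j\<in>J. T (a(j := f j))) (\<beta> p q) = (\<Sum>k<r. T (d k)) (\<beta> p q)"
      using eq by simp
    then show "0 * prod p J + (\<Sum>j\<in>J. 1 * q j * prod p (J - {j})) =
      (\<Sum>k<r. (\<Prod>i\<in>{1..n}-J. \<phi> i (d k i)) * (\<Prod>j\<in>J. p j * \<phi> j (d k j) + q j * \<psi> j (d k j)))"
      by (simp add: sum_fun_apply lhs rhs cong: sum.cong)
  qed (use fin in auto)
  then show ?thesis by simp
qed

text \<open>The sum is itself a decomposition with \<open>card J\<close> terms. The set
  \<open>J\<close> may have any size, so the lemma gives both the rank in form (c) and examples of
  every rank.\<close>

lemma tangent_sum_rank:
  assumes a: "a \<in> nonzero_families" and J: "J \<subseteq> {1..n}"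
    and ind: "\<And>j. j \<in> J \<Longrightarrow> f j \<notin> span {a j}"
    and f: "\<And>j. j \<in> J \<Longrightarrow> f j \<in> A j"
  shows "tensor_rank s A n (\<Sum>j\<in>J. T (a(j := f j))) = card J"
proof (rule antisym)
  have fin: "finite J" using J finite_subset by blast
  have fam: "a(j := f j) \<in> families" if "j \<in> J" for j
    using that a f J by (auto simp: families_def nonzero_families_def)
  show "tensor_rank s A n (\<Sum>j\<in>J. T (a(j := f j))) \<le> card J"
    by (rule tensor_rank_le) (use fin fam in auto)
  obtain h where h: "bij_betw h {..<card J} J"
    using ex_bij_betw_nat_finite[OF fin] by (auto simp: atLeast0LessThan)
  show "card J \<le> tensor_rank s A n (\<Sum>j\<in>J. T (a(j := f j)))"
  proof (rule tensor_rank_ge)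
    show "(\<Sum>j\<in>J. T (a(j := f j))) = (\<Sum>k<card J. T (a(h k := f (h k))))"
      using sum.reindex_bij_betw[OF h, of "\<lambda>k. T (a(k := f k))"] by simp
    show "a(h k := f (h k)) \<in> families" if "k < card J" for k
      using that h fam by (auto simp: bij_betw_def)
  qed (rule tangent_sum_rank_ge[OF assms(1-3)], use f in auto)
qed

lemma rank_normal_form_a:
  assumes "a \<in> nonzero_families"
  shows "tensor_rank s A n (T a) = 1"
proof (rule antisym)
  show "tensor_rank s A n (T a) \<le> 1"
    using tensor_rank_le[of "{()}" "\<lambda>_. a"] nonzero_families_subset[OF assms] by simp
  show "1 \<le> tensor_rank s A n (T a)"
  proof (rule tensor_rank_ge[of _ "\<lambda>_. a" 1])
    fix r :: nat and d assume "T a = (\<Sum>k<r. T (d k))"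
    with tensor_nonzero[OF assms] show "1 \<le> r" by (cases r) auto
  qed (use nonzero_families_subset[OF assms] in auto)
qed

text \<open>Contracting all slots but two independent ones, \<open>i\<close> and \<open>l\<close>,
  turns \<open>T a + T b\<close> into a diagonal 2x2 matrix with nonzero diagonal, whereas a
  decomposable \<open>T d\<close> gives a matrix of rank at most 1. The functionals
  \<open>\<psi>i\<close>, \<open>\<psi>l\<close> kill \<open>T a\<close> but not \<open>T b\<close>,
  which separates the two points.\<close>

lemma rank_normal_form_b:
  assumes a: "a \<in> nonzero_families" and b: "b \<in> nonzero_families"
    and card: "card {i\<in>{1..n}. b i \<notin> span {a i}} \<ge> 2"
  shows "tensor_rank s A n (T a + T b) = 2" "fct.span {T a} \<noteq> fct.span {T b}"
proof -
  obtain i l where il: "i \<in> {1..n}" "l \<in> {1..n}" "i \<noteq> l" "b i \<notin> span {a i}" "b l \<notin> span {a l}"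
    using card by (auto simp: numeral_2_eq_2 card_le_Suc_iff)
  have ai: "a i \<noteq> 0" "a l \<noteq> 0" using a il by (auto simp: nonzero_families_def)
  \<comment> \<open>The slots other than \<open>i\<close> and \<open>l\<close> are contracted with
    functionals vanishing on neither vector, so they contribute nonzero factors.\<close>
  have "\<exists>\<phi>. \<phi> \<in> dual_space s (A j) \<and> \<phi> (a j) \<noteq> 0 \<and> \<phi> (b j) \<noteq> 0" if "j \<in> {1..n}" for j
  proof -
    have "a j \<in> A j" "b j \<in> A j" "a j \<noteq> 0" "b j \<noteq> 0"
      using a b that by (auto simp: nonzero_families_def)
    then show ?thesis by (rule functional_nonzero_on_two) blast
  qed
  then obtain \<theta> where \<theta>: "\<And>j. j \<in> {1..n} \<Longrightarrow> \<theta> j \<in> dual_space s (A j) \<and> \<theta> j (a j) \<noteq> 0 \<and> \<theta> j (b j) \<noteq> 0"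
    by metis
  obtain \<phi>i where \<phi>i: "\<phi>i \<in> dual_space s (A i)" "\<phi>i (a i) = 1" "\<phi>i (b i) = 0"
    using functional_on_pair[OF ai(1) il(4)] .
  obtain \<psi>i where \<psi>i: "\<psi>i \<in> dual_space s (A i)" "\<psi>i (a i) = 0" "\<psi>i (b i) = 1"
    using functional_on_pair[OF ai(1) il(4)] .
  obtain \<phi>l where \<phi>l: "\<phi>l \<in> dual_space s (A l)" "\<phi>l (a l) = 1" "\<phi>l (b l) = 0"
    using functional_on_pair[OF ai(2) il(5)] .
  obtain \<psi>l where \<psi>l: "\<psi>l \<in> dual_space s (A l)" "\<psi>l (a l) = 0" "\<psi>l (b l) = 1"
    using functional_on_pair[OF ai(2) il(5)] .
  let ?R = "{1..n} - {i} - {l}"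
  have eval: "\<theta>(i := \<phi>, l := \<psi>) \<in> dual_families"
    "T d (\<theta>(i := \<phi>, l := \<psi>)) = \<phi> (d i) * (\<psi> (d l) * (\<Prod>j\<in>?R. \<theta> j (d j)))"
    if "\<phi> \<in> dual_space s (A i)" "\<psi> \<in> dual_space s (A l)" for \<phi> \<psi> d
  proof -
    show *: "\<theta>(i := \<phi>, l := \<psi>) \<in> dual_families"
      using that \<theta> by (auto simp: dual_families_def)
    have "(\<Prod>j\<in>?R. (\<theta>(i := \<phi>, l := \<psi>)) j (d j)) = (\<Prod>j\<in>?R. \<theta> j (d j))"
      by (intro prod.cong) auto
    then show "T d (\<theta>(i := \<phi>, l := \<psi>)) = \<phi> (d i) * (\<psi> (d l) * (\<Prod>j\<in>?R. \<theta> j (d j)))"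
      using il prod.remove[of "{1..n}" i "\<lambda>j. (\<theta>(i := \<phi>, l := \<psi>)) j (d j)"]
        prod.remove[of "{1..n}-{i}" l "\<lambda>j. (\<theta>(i := \<phi>, l := \<psi>)) j (d j)"]
      by (simp add: tensor_apply[OF *])
  qed
  have ne: "(\<Prod>j\<in>?R. \<theta> j (a j)) \<noteq> 0" "(\<Prod>j\<in>?R. \<theta> j (b j)) \<noteq> 0"
    using \<theta> by auto
  have not_dec: "T a + T b \<noteq> T d" for d
  proof
    assume eq: "T a + T b = T d"
    then have *: "T a \<beta> + T b \<beta> = T d \<beta>" for \<beta> by (metis plus_fun_apply)
    let ?w = "\<Prod>j\<in>?R. \<theta> j (d j)"
    have "\<phi>i (d i) * (\<phi>l (d l) * ?w) = (\<Prod>j\<in>?R. \<theta> j (a j))"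
      using *[of "\<theta>(i := \<phi>i, l := \<phi>l)"] by (simp add: eval \<phi>i \<phi>l)
    moreover have "\<psi>i (d i) * (\<psi>l (d l) * ?w) = (\<Prod>j\<in>?R. \<theta> j (b j))"
      using *[of "\<theta>(i := \<psi>i, l := \<psi>l)"] by (simp add: eval \<psi>i \<psi>l)
    moreover have "\<phi>i (d i) * (\<psi>l (d l) * ?w) = 0"
      using *[of "\<theta>(i := \<phi>i, l := \<psi>l)"] by (simp add: eval \<phi>i \<psi>l)
    ultimately show False using ne by (metis mult_eq_0_iff)
  qed
  show "tensor_rank s A n (T a + T b) = 2"
  proof (rule antisym)
    have fam: "(if k then a else b) \<in> families" for k
      using a b nonzero_families_subset by auto
    \<comment> \<open>The type \<open>bool\<close> serves as an index set with two elements.\<close>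
    show "tensor_rank s A n (T a + T b) \<le> 2"
      using tensor_rank_le[of UNIV "\<lambda>k. if k then a else b"] fam by (simp add: UNIV_bool add.commute)
    show "2 \<le> tensor_rank s A n (T a + T b)"
    proof (rule tensor_rank_ge[of _ "\<lambda>k. if k = 0 then a else b" 2])
      fix r :: nat and d assume d: "T a + T b = (\<Sum>k<r. T (d k))"
      \<comment> \<open>An empty sum is 0, which is itself decomposable, so \<open>not_dec\<close>
        excludes this case too.\<close>
      have "r \<noteq> 0"
      proof
        assume "r = 0"
        moreover have "T (\<lambda>_. 0) = 0" using n_ge_1 by (intro tensor_eq_0[of 1]) auto
        ultimately show False using d not_dec[of "\<lambda>_. 0"] by simp
      qed
      moreover have "r \<noteq> 1" using d not_dec[of "d 0"] by auto
      ultimately show "2 \<le> r" by linarith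
    qed (use fam in \<open>auto simp: numeral_2_eq_2 lessThan_Suc add.commute nonzero_families_subset a b\<close>)
  qed
  show "fct.span {T a} \<noteq> fct.span {T b}"
  proof
    assume "fct.span {T a} = fct.span {T b}"
    then have "T b \<in> fct.span {T a}" using fct.span_base by blast
    then obtain c where "T b = cscale c (T a)" by (auto simp: fct.span_singleton)
    then have *: "T b \<beta> = c * T a \<beta>" for \<beta> by (simp add: cscale_def)
    show False
      using *[of "\<theta>(i := \<psi>i, l := \<psi>l)"] ne by (simp add: eval \<psi>i \<psi>l)
  qed
qed

end

section \<open>Compactness, telescoping and weak limits in the factors\<close>

text \<open>Finer filters play the role of convergent subsequences.\<close>

lemma finer_filter_in_compact:
  assumes "compact K" "F \<noteq> bot" "\<And>t. g t \<in> K"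
  obtains x G where "x \<in> K" "G \<le> F" "G \<noteq> bot" "(g \<longlongrightarrow> x) G"
proof -
  have "filtermap g F \<noteq> bot" using assms(2) by (simp add: filtermap_bot_iff)
  moreover have "eventually (\<lambda>x. x \<in> K) (filtermap g F)"
    using assms(3) by (simp add: eventually_filtermap)
  ultimately obtain x where x: "x \<in> K" "inf (nhds x) (filtermap g F) \<noteq> bot"
    using assms(1) unfolding compact_filter by blast
  \<comment> \<open>The coarsest filter below \<open>F\<close> along which \<open>g\<close> tends to
    \<open>x\<close>; it is proper because \<open>x\<close> is a cluster point of the image
    filter.\<close>
  let ?G = "inf F (filtercomap g (nhds x))"
  have "?G \<noteq> bot"
  proof
    assume "?G = bot"
    then have "eventually (\<lambda>_. False) ?G" by simp
    then obtain Q P where Q: "eventually Q F" and P: "eventually P (nhds x)"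
      and "\<And>t. Q t \<Longrightarrow> P (g t) \<Longrightarrow> False"
      unfolding eventually_inf eventually_filtercomap by blast
    then have "eventually (\<lambda>t. \<not> P (g t)) F"
      by (elim eventually_mono) blast
    then have "eventually (\<lambda>_. False) (inf (nhds x) (filtermap g F))"
      using P unfolding eventually_inf eventually_filtermap
      by (intro exI[of _ P] exI[of _ "\<lambda>y. \<not> P y"]) auto
    with x(2) show False by (simp add: eventually_False)
  qed
  moreover have "(g \<longlongrightarrow> x) ?G"
    by (rule filterlim_mono[OF filterlim_filtercomap]) auto
  ultimately show ?thesis using that x(1) by (meson inf_le1)
qed

text \<open>Tychonoff's theorem, as functions carry the product topology.\<close>

lemma compact_unit_polydisc: "compact {f :: 'i \<Rightarrow> complex. \<forall>i. norm (f i) \<le> 1}"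
proof -
  have "compactin (product_topology (\<lambda>i::'i. euclidean) UNIV) (PiE UNIV (\<lambda>i::'i. cball (0::complex) 1))"
    unfolding compactin_PiE by auto
  moreover have "PiE UNIV (\<lambda>i::'i. cball (0::complex) 1) = {f. \<forall>i. norm (f i) \<le> 1}"
    by (auto simp: PiE_def Pi_def)
  ultimately show ?thesis
    by (simp add: euclidean_product_topology)
qed

lemma tendsto_apply: "(g \<longlongrightarrow> g0) F \<Longrightarrow> ((\<lambda>t. g t i) \<longlongrightarrow> g0 i) F"
  for g :: "'t \<Rightarrow> 'i \<Rightarrow> 'b::topological_space"
  by (rule continuous_on_tendsto_compose[OF continuous_on_product_coordinates]) auto

text \<open>Replace \<open>u\<close> by \<open>v\<close> one slot at a time from the left: term
  \<open>j\<close> already has \<open>v\<close> below \<open>j\<close> and still has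
  \<open>u\<close> above.\<close>

lemma prod_diff_telescope:
  fixes u v :: "nat \<Rightarrow> 'a::comm_ring_1"
  shows "(\<Prod>j=1..n. v j) - (\<Prod>j=1..n. u j) =
    (\<Sum>j=1..n. (v j - u j) * ((\<Prod>i\<in>{1..<j}. v i) * (\<Prod>i\<in>{j<..n}. u i)))"
proof (induction n)
  case (Suc n)
  have "(\<Prod>i\<in>{j<..Suc n}. u i) = u (Suc n) * (\<Prod>i\<in>{j<..n}. u i)" if "j \<in> {1..n}" for j
  proof -
    have "{j<..Suc n} = insert (Suc n) {j<..n}" using that by auto
    then show ?thesis by simp
  qed
  then have "(\<Sum>j=1..n. (v j - u j) * ((\<Prod>i\<in>{1..<j}. v i) * (\<Prod>i\<in>{j<..Suc n}. u i))) =
     u (Suc n) * (\<Sum>j=1..n. (v j - u j) * ((\<Prod>i\<in>{1..<j}. v i) * (\<Prod>i\<in>{j<..n}. u i)))"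
    unfolding sum_distrib_left by (intro sum.cong) (auto simp: ac_simps)
  then have "(\<Sum>j=1..Suc n. (v j - u j) * ((\<Prod>i\<in>{1..<j}. v i) * (\<Prod>i\<in>{j<..Suc n}. u i))) =
     u (Suc n) * ((\<Prod>j=1..n. v j) - (\<Prod>j=1..n. u j)) + (v (Suc n) - u (Suc n)) * (\<Prod>j=1..n. v j)"
    using Suc.IH by (simp add: atLeastLessThanSuc_atLeastAtMost)
  then show ?case by (simp add: algebra_simps)
qed auto

text \<open>Cramer's rule for a 2x2 system whose coefficient matrix tends to the invertible diagonal
  matrix with entries \<open>P\<close> and \<open>U\<close>. Convergence of \<open>m\<close> follows
  by exchanging the two unknowns and the two equations.\<close>

lemma cramer_tendsto:
  fixes l m :: "'t \<Rightarrow> complex"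
  assumes "(p \<longlongrightarrow> P) F" "(q \<longlongrightarrow> 0) F" "(r \<longlongrightarrow> 0) F" "(u \<longlongrightarrow> U) F" "P \<noteq> 0" "U \<noteq> 0"
    and "((\<lambda>t. l t * p t + m t * q t) \<longlongrightarrow> X) F" "((\<lambda>t. l t * r t + m t * u t) \<longlongrightarrow> Y) F"
  shows "\<exists>l0. (l \<longlongrightarrow> l0) F"
proof -
  let ?D = "\<lambda>t. p t * u t - q t * r t"
  have D: "(?D \<longlongrightarrow> P * U - 0 * 0) F" by (intro tendsto_intros assms)
  have "((\<lambda>t. ((l t * p t + m t * q t) * u t - (l t * r t + m t * u t) * q t) / ?D t) \<longlongrightarrow>
      (X * U - Y * 0) / (P * U - 0 * 0)) F"
    by (intro tendsto_divide tendsto_diff tendsto_mult assms) (use assms in auto)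
  moreover have "eventually (\<lambda>t. ?D t \<noteq> 0) F"
    by (rule tendsto_imp_eventually_ne[OF D]) (use assms in auto)
  then have "eventually (\<lambda>t. ((l t * p t + m t * q t) * u t - (l t * r t + m t * u t) * q t) / ?D t = l t) F"
    by (elim eventually_mono) (simp add: field_simps)
  ultimately show ?thesis
    by (blast intro: Lim_transform_eventually)
qed

context tensor_factors
begin

text \<open>The factor \<open>A j\<close> carries no topology, so convergence is tested on
  functionals; in finite dimension this is convergence of coordinates. Members of
  \<open>dual_space s (A j)\<close> are linear only on \<open>A j\<close>, so the notion is
  meaningful for vectors of \<open>A j\<close>.\<close>

definition weak_tendsto :: "nat \<Rightarrow> ('t \<Rightarrow> 'v) \<Rightarrow> 'v \<Rightarrow> 't filter \<Rightarrow> bool" where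
  "weak_tendsto j v v0 F \<longleftrightarrow> (\<forall>\<beta>\<in>dual_space s (A j). ((\<lambda>t. \<beta> (v t)) \<longlongrightarrow> \<beta> v0) F)"

lemma weak_tendsto_mono: "weak_tendsto j v v0 F \<Longrightarrow> G \<le> F \<Longrightarrow> weak_tendsto j v v0 G"
  unfolding weak_tendsto_def using tendsto_mono by blast

lemma basis_of_A:
  assumes "j \<in> {1..n}"
  shows "\<exists>B. finite B \<and> independent B \<and> span B = A j"
proof -
  obtain C where C: "finite C" "A j = span C" using finitely_spanned_A[OF assms] by blast
  obtain B where "B \<subseteq> C" "independent B" "C \<subseteq> span B" using maximal_independent_subset[of C] by blast
  with C show ?thesis
    by (metis finite_subset span_minimal span_mono subset_antisym subspace_span)
qed

lemma A_sum: "j \<in> {1..n} \<Longrightarrow> (\<And>k. k \<in> K \<Longrightarrow> f k \<in> A j) \<Longrightarrow> sum f K \<in> A j"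
  using subspace_A subspace_sum by blast

lemma dual_space_sum_scale:
  assumes "\<beta> \<in> dual_space s (A j)" "j \<in> {1..n}" "\<And>k. k \<in> K \<Longrightarrow> f k \<in> A j"
  shows "\<beta> (\<Sum>k\<in>K. s (c k) (f k)) = (\<Sum>k\<in>K. c k * \<beta> (f k))"
  using assms(3)
proof (induction K rule: infinite_finite_induct)
  case (insert k K)
  then show ?case
    using assms(1,2) by (simp add: dual_space_add[OF assms(1)] dual_space_scale[OF assms(1)] A_scale A_sum)
qed (use dual_space_scale[OF assms(1) A_zero[OF assms(2)], of 0] in auto)

lemma weak_tendsto_sum_scale:
  assumes "j \<in> {1..n}" "\<And>b. b \<in> B \<Longrightarrow> b \<in> A j" "\<And>b. b \<in> B \<Longrightarrow> ((\<lambda>t. c t b) \<longlongrightarrow> c0 b) F"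
  shows "weak_tendsto j (\<lambda>t. \<Sum>b\<in>B. s (c t b) b) (\<Sum>b\<in>B. s (c0 b) b) F"
  unfolding weak_tendsto_def
proof
  fix \<beta> assume \<beta>: "\<beta> \<in> dual_space s (A j)"
  have eq: "\<beta> (\<Sum>b\<in>B. s (d b) b) = (\<Sum>b\<in>B. d b * \<beta> b)" for d
    using dual_space_sum_scale[OF \<beta> assms(1), of B "\<lambda>b. b"] assms(2) by auto
  show "((\<lambda>t. \<beta> (\<Sum>b\<in>B. s (c t b) b)) \<longlongrightarrow> \<beta> (\<Sum>b\<in>B. s (c0 b) b)) F"
    unfolding eq
    by (intro tendsto_sum tendsto_mult_right assms(3))
qed

text \<open>Coordinates in a basis are functionals, and their limits are the coordinates of the
  limit vector.\<close>

lemma weak_tendsto_exists: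
  assumes j: "j \<in> {1..n}" and v: "\<And>t. v t \<in> A j"
    and lim: "\<And>\<beta>. \<beta> \<in> dual_space s (A j) \<Longrightarrow> \<exists>l. ((\<lambda>t. \<beta> (v t)) \<longlongrightarrow> l) F"
  shows "\<exists>v0\<in>A j. weak_tendsto j v v0 F"
proof -
  obtain B where B: "finite B" "independent B" "span B = A j" using basis_of_A[OF j] by blast
  have "(\<lambda>v. representation B v b) \<in> dual_space s (A j)" for b
    using B by (auto simp: dual_space_def representation_add representation_scale)
  then have "\<exists>l. ((\<lambda>t. representation B (v t) b) \<longlongrightarrow> l) F" for b by (rule lim)
  then obtain l where l: "\<And>b. ((\<lambda>t. representation B (v t) b) \<longlongrightarrow> l b) F" by metis
  have BA: "b \<in> A j" if "b \<in> B" for b using that B span_base by blast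
  have "v = (\<lambda>t. \<Sum>b\<in>B. s (representation B (v t) b) b)"
    using sum_representation_eq[OF B(2) _ B(1)] B v by simp
  moreover have "weak_tendsto j (\<lambda>t. \<Sum>b\<in>B. s (representation B (v t) b) b) (\<Sum>b\<in>B. s (l b) b) F"
    by (rule weak_tendsto_sum_scale) (use j BA l in auto)
  ultimately have "weak_tendsto j v (\<Sum>b\<in>B. s (l b) b) F" by simp
  moreover have "(\<Sum>b\<in>B. s (l b) b) \<in> A j"
    using BA j by (intro A_sum A_scale)
  ultimately show ?thesis by blast
qed

text \<open>Each factor is rescaled so that the absolute values of its coordinates sum to 1. All
  coordinates then lie in a compact polydisc, and the normalisation survives in the limit, so the
  limit vectors are nonzero.\<close>

lemma normalised_directions_accumulate:
  fixes a :: "'t \<Rightarrow> nat \<Rightarrow> 'v"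
  assumes "F \<noteq> bot" and a: "\<And>t. a t \<in> nonzero_families"
  obtains G c a0 where "G \<le> F" "G \<noteq> bot" "\<And>t j. j \<in> {1..n} \<Longrightarrow> c t j \<noteq> 0" "a0 \<in> nonzero_families"
    "\<And>j. j \<in> {1..n} \<Longrightarrow> weak_tendsto j (\<lambda>t. s (c t j) (a t j)) (a0 j) G"
proof -
  obtain B where B: "\<And>j. j \<in> {1..n} \<Longrightarrow> finite (B j) \<and> independent (B j) \<and> span (B j) = A j"
    using basis_of_A by metis
  have BA: "b \<in> A j" if "b \<in> B j" "j \<in> {1..n}" for b j using that B span_base by blast
  define r where "r t j b = representation (B j) (a t j) b" for t j b
  define N where "N t j = (\<Sum>b\<in>B j. norm (r t j b))" for t j
  have rep: "a t j = (\<Sum>b\<in>B j. s (r t j b) b)" if "j \<in> {1..n}" for t j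
    unfolding r_def using sum_representation_eq[of "B j" "a t j" "B j"] B[OF that] a[of t] that
    by (simp add: nonzero_families_def)
  have N: "N t j \<noteq> 0" if "j \<in> {1..n}" for t j
  proof
    assume "N t j = 0"
    then have "\<forall>b\<in>B j. r t j b = 0"
      unfolding N_def using B[OF that] by (subst (asm) sum_nonneg_eq_0_iff) auto
    then have "a t j = 0" using rep[OF that, of t] by simp
    then show False using a[of t] that by (auto simp: nonzero_families_def)
  qed
  \<comment> \<open>The coordinates of all slots form one function of pairs (slot, basis vector),
    extended by 0, so that a single passage to a finer filter treats all slots at once.\<close>
  define g where "g t jb = (if fst jb \<in> {1..n} \<and> snd jb \<in> B (fst jb)
      then r t (fst jb) (snd jb) / N t (fst jb) else 0)" for t jb
  have norm_g: "norm (g t jb) \<le> 1" for t jb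
  proof (cases "fst jb \<in> {1..n} \<and> snd jb \<in> B (fst jb)")
    case True
    then have "norm (r t (fst jb) (snd jb)) \<le> N t (fst jb)"
      unfolding N_def using B by (intro member_le_sum) auto
    moreover have "0 \<le> N t (fst jb)" unfolding N_def by (intro sum_nonneg) auto
    ultimately show ?thesis
      using True N[of "fst jb" t] by (simp add: g_def norm_divide divide_le_eq_1)
  qed (auto simp: g_def)
  obtain g0 G where G: "G \<le> F" "G \<noteq> bot" "(g \<longlongrightarrow> g0) G"
    by (rule finer_filter_in_compact[OF compact_unit_polydisc assms(1), of g]) (use norm_g in auto)
  have g0: "((\<lambda>t. g t (j, b)) \<longlongrightarrow> g0 (j, b)) G" for j b
    by (rule tendsto_apply[OF G(3)])
  define c where "c t j = (1 / N t j :: complex)" for t j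
  define a0 where "a0 j = (\<Sum>b\<in>B j. s (g0 (j, b)) b)" for j
  have lim: "weak_tendsto j (\<lambda>t. s (c t j) (a t j)) (a0 j) G" if j: "j \<in> {1..n}" for j
  proof -
    have "s (c t j) (a t j) = (\<Sum>b\<in>B j. s (g t (j, b)) b)" for t
      using j by (subst rep[OF j]) (auto simp: scale_sum_right g_def c_def intro!: sum.cong)
    moreover have "weak_tendsto j (\<lambda>t. \<Sum>b\<in>B j. s (g t (j, b)) b) (a0 j) G"
      unfolding a0_def by (rule weak_tendsto_sum_scale) (use j BA g0 in auto)
    ultimately show ?thesis by simp
  qed
  \<comment> \<open>By independence a zero limit has only zero coordinates, but the absolute values
    of the coordinates sum to 1 for every \<open>t\<close>.\<close>
  have "a0 j \<noteq> 0" if j: "j \<in> {1..n}" for j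
  proof
    assume "a0 j = 0"
    then have "\<And>b. b \<in> B j \<Longrightarrow> g0 (j, b) = 0"
      unfolding a0_def using independentD[of "B j" "B j" "\<lambda>b. g0 (j, b)"] B[OF j] by blast
    moreover have "((\<lambda>t. \<Sum>b\<in>B j. norm (g t (j, b))) \<longlongrightarrow> (\<Sum>b\<in>B j. norm (g0 (j, b)))) G"
      by (intro tendsto_intros g0)
    moreover have "(\<Sum>b\<in>B j. norm (g t (j, b))) = 1" for t
    proof -
      have "0 \<le> N t j" unfolding N_def by (intro sum_nonneg) auto
      then have "(\<Sum>b\<in>B j. norm (g t (j, b))) = (\<Sum>b\<in>B j. norm (r t j b) / N t j)"
        using j by (intro sum.cong) (auto simp: g_def norm_divide)
      also have "\<dots> = N t j / N t j"
        unfolding N_def sum_divide_distrib ..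
      finally have "(\<Sum>b\<in>B j. norm (g t (j, b))) = N t j / N t j" .
      then show ?thesis using N[OF j] by simp
    qed
    ultimately have "((\<lambda>t. 1 :: real) \<longlongrightarrow> 0) G" by simp
    with G(2) show False by (simp add: tendsto_const_iff)
  qed
  moreover have "a0 j \<in> A j" if "j \<in> {1..n}" for j
    unfolding a0_def using that BA by (intro A_sum A_scale) auto
  ultimately have "a0 \<in> nonzero_families" by (auto simp: nonzero_families_def)
  with G lim N show ?thesis
    by (intro that[of G c a0]) (auto simp: c_def)
qed

lemma tensor_tendsto:
  assumes "\<And>j. j \<in> {1..n} \<Longrightarrow> weak_tendsto j (\<lambda>t. a t j) (a0 j) F"
  shows "((\<lambda>t. T (a t) \<beta>) \<longlongrightarrow> T a0 \<beta>) F"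
proof (cases "\<beta> \<in> dual_families")
  case True
  then show ?thesis
    using assms dual_familiesD[OF True] unfolding tensor_apply[OF True] weak_tendsto_def
    by (intro tendsto_prod) auto
qed (simp add: tensor_outside)

end

section \<open>Reduction of sums and tangent vectors to the normal forms\<close>

context tensor_factors
begin

text \<open>The scalar is absorbed into slot 1, which exists because
  \<open>n \<ge> 1\<close>.\<close>

lemma cscale_tensor:
  assumes "a \<in> families"
  shows "cscale c (T a) = T (a(1 := s c (a 1)))"
  using assms n_ge_1 tensor_upd_scale[of 1 "a 1" a c] by (simp add: families_def)

lemma families_upd: "a \<in> families \<Longrightarrow> (j \<in> {1..n} \<Longrightarrow> v \<in> A j) \<Longrightarrow> a(j := v) \<in> families"
  unfolding families_def by auto

lemma nonzero_families_upd:
  "a \<in> nonzero_families \<Longrightarrow> (j \<in> {1..n} \<Longrightarrow> v \<in> A j \<and> v \<noteq> 0) \<Longrightarrow> a(j := v) \<in> nonzero_families"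
  unfolding nonzero_families_def by auto

lemma normal_form_b_iff:
  "normal_form_b s A n x \<longleftrightarrow> (\<exists>a\<in>nonzero_families. \<exists>b\<in>nonzero_families.
     2 \<le> card {i\<in>{1..n}. b i \<notin> span {a i}} \<and> x = T a + T b)"
  unfolding normal_form_b_def nonzero_families_def by (auto simp: Ball_def)

text \<open>If the directions of \<open>a\<close> and \<open>b\<close> differ in at most one slot
  \<open>i\<close>, the other factors of \<open>b\<close> are multiples of those of
  \<open>a\<close>, and the sum collapses to one decomposable tensor by adding in slot
  \<open>i\<close>.\<close>

lemma normal_form_sum_of_two:
  assumes a: "a \<in> nonzero_families" and b: "b \<in> nonzero_families"
    and x: "x = T a + T b" "x \<noteq> 0"
  shows "normal_form_a s A n x \<or> normal_form_b s A n x"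
proof (cases "card {i\<in>{1..n}. b i \<notin> span {a i}} \<ge> 2")
  case True
  then show ?thesis
    using a b x unfolding normal_form_b_iff by blast
next
  case False
  let ?D = "{i\<in>{1..n}. b i \<notin> span {a i}}"
  \<comment> \<open>If the directions agree everywhere, any slot can serve as \<open>i\<close>, and
    slot 1 is taken.\<close>
  have "\<exists>i\<in>{1..n}. ?D \<subseteq> {i}"
  proof (cases "?D = {}")
    case True
    then show ?thesis using n_ge_1 by (intro bexI[of _ 1]) auto
  next
    case ne: False
    have "finite ?D" by simp
    with ne have "card ?D \<noteq> 0" by (metis card_0_eq)
    with False have "card ?D = 1" by linarith
    then obtain i where "?D = {i}" by (auto simp: card_1_singleton_iff)
    then show ?thesis by blast
  qed
  then obtain i where i: "i \<in> {1..n}" "?D \<subseteq> {i}" by blast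
  have "\<exists>c. b j = s c (a j)" if "j \<in> {1..n} - {i}" for j
    using i that by (auto simp: span_singleton)
  then obtain c where c: "\<And>j. j \<in> {1..n} - {i} \<Longrightarrow> b j = s (c j) (a j)" by metis
  \<comment> \<open>Slot \<open>i\<close> keeps the vector \<open>b i\<close> itself, hence the
    factor 1 there.\<close>
  define c' where "c' j = (if j = i then 1 else c j)" for j
  let ?g = "a(i := b i)"
  have g: "?g \<in> families"
    using a b i by (intro families_upd[OF nonzero_families_subset]) (auto simp: nonzero_families_def)
  have "T b = T (\<lambda>j. s (c' j) (?g j))"
    by (rule tensor_cong) (auto simp: c'_def c)
  also have "\<dots> = cscale (\<Prod>j=1..n. c' j) (T ?g)"
    by (rule tensor_scale_all[OF g])
  also have "\<dots> = T (a(i := s (\<Prod>j=1..n. c' j) (b i)))"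
    using i b by (subst tensor_upd_scale) (auto simp: nonzero_families_def)
  finally have "x = T (a(i := a i + s (\<Prod>j=1..n. c' j) (b i)))"
    using x i a b by (subst tensor_upd_add) (auto simp: nonzero_families_def A_scale)
  moreover have "a(i := a i + s (\<Prod>j=1..n. c' j) (b i)) \<in> families"
    using a b i by (intro families_upd[OF nonzero_families_subset]) (auto simp: nonzero_families_def A_add A_scale)
  ultimately show ?thesis using x(2) normal_form_aI by blast
qed

lemma normal_form_combination_of_two:
  assumes a: "a \<in> nonzero_families" and b: "b \<in> nonzero_families"
    and x: "x = cscale l (T a) + cscale m (T b)" "x \<noteq> 0"
  shows "normal_form_a s A n x \<or> normal_form_b s A n x"
proof -
  have 1: "1 \<in> {1..n}" using n_ge_1 by simp
  have fam: "a(1 := s l (a 1)) \<in> families" "b(1 := s m (b 1)) \<in> families"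
    using a b 1 by (auto intro!: families_upd[OF nonzero_families_subset] simp: A_scale)
      (auto simp: nonzero_families_def A_scale)
  have x': "x = T (a(1 := s l (a 1))) + T (b(1 := s m (b 1)))"
    using x a b by (simp add: cscale_tensor nonzero_families_subset)
  show ?thesis
  \<comment> \<open>A zero coefficient makes the absorbed factor zero and leaves the nonzero
    families; then only one decomposable term is left.\<close>
  proof (cases "l = 0 \<or> m = 0")
    case True
    then have "x = T (b(1 := s m (b 1))) \<or> x = T (a(1 := s l (a 1)))"
      unfolding cscale_tensor[OF nonzero_families_subset[OF a], symmetric]
        cscale_tensor[OF nonzero_families_subset[OF b], symmetric]
      using x(1) by auto
    then show ?thesis using fam x(2) normal_form_aI by blast
  next
    case False
    have "a(1 := s l (a 1)) \<in> nonzero_families" "b(1 := s m (b 1)) \<in> nonzero_families"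
      using a b 1 False by (auto intro!: nonzero_families_upd simp: A_scale nonzero_families_def)
    then show ?thesis using normal_form_sum_of_two x' x(2) by blast
  qed
qed

text \<open>The multiple of \<open>T e\<close> is absorbed into one nonzero direction
  \<open>y j0\<close>. The number of nonzero directions decides the form: none or one gives (a), two
  give (b), more give (c).\<close>

lemma normal_form_tangent:
  assumes e: "e \<in> nonzero_families"
    and y: "\<And>j. j \<in> {1..n} \<Longrightarrow> y j \<in> A j" "\<And>j. j \<in> {1..n} \<Longrightarrow> y j \<in> span {e j} \<Longrightarrow> y j = 0"
    and x: "x = cscale \<nu> (T e) + (\<Sum>j=1..n. T (e(j := y j)))" "x \<noteq> 0"
  shows "normal_form_a s A n x \<or> normal_form_b s A n x \<or> (\<exists>J. normal_form_c s A n J x)"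
proof -
  define J where "J = {j\<in>{1..n}. y j \<noteq> 0}"
  have J: "finite J" "J \<subseteq> {1..n}" unfolding J_def by auto
  have eA: "e j \<in> A j" "e j \<noteq> 0" if "j \<in> {1..n}" for j using e that by (auto simp: nonzero_families_def)
  have "(\<Sum>j=1..n. T (e(j := y j))) = (\<Sum>j\<in>J. T (e(j := y j)))"
    by (rule sum.mono_neutral_right) (auto simp: J_def intro: tensor_eq_0)
  with x have x': "x = cscale \<nu> (T e) + (\<Sum>j\<in>J. T (e(j := y j)))" by simp
  show ?thesis
  proof (cases "J = {}")
    case True
    then have "x = T (e(1 := s \<nu> (e 1)))"
      using x' e by (simp add: cscale_tensor nonzero_families_subset)
    moreover have "e(1 := s \<nu> (e 1)) \<in> families"
      using e by (auto intro!: families_upd[OF nonzero_families_subset] simp: A_scale eA)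
    ultimately show ?thesis using normal_form_aI x(2) by blast
  next
    case False
    then obtain j0 where j0: "j0 \<in> J" by blast
    \<comment> \<open>Adding \<open>s \<nu> (e j0)\<close> in slot \<open>j0\<close> contributes
      exactly \<open>cscale \<nu> (T e)\<close> and keeps the vector independent of
      \<open>e j0\<close>.\<close>
    define f where "f = y(j0 := y j0 + s \<nu> (e j0))"
    have fA: "f j \<in> A j" if "j \<in> {1..n}" for j
      using that y eA by (auto simp: f_def A_add A_scale)
    have find: "f j \<notin> span {e j}" if "j \<in> J" for j
    proof
      assume f: "f j \<in> span {e j}"
      have "y j = f j - (if j = j0 then s \<nu> (e j) else 0)" by (auto simp: f_def)
      moreover have "\<dots> \<in> span {e j}"
        using f by (intro span_diff) (auto simp: span_zero intro: span_scale span_base)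
      ultimately show False using y(2)[of j] that by (auto simp: J_def)
    qed
    have f0: "f j \<noteq> 0" if "j \<in> J" for j using find[OF that] span_zero by metis
    have "T (e(j0 := f j0)) = T (e(j0 := y j0)) + cscale \<nu> (T (e(j0 := e j0)))"
      using j0 J y eA by (auto simp: f_def tensor_upd_add A_scale tensor_upd_scale subset_iff simp del: fun_upd_triv)
    moreover have "(\<Sum>j\<in>J-{j0}. T (e(j := y j))) = (\<Sum>j\<in>J-{j0}. T (e(j := f j)))"
      by (rule sum.cong) (auto simp: f_def)
    ultimately have "x = (\<Sum>j\<in>J. T (e(j := f j)))"
      using j0 J unfolding x' by (simp add: sum.remove[of J j0])
    note x = this x(2)
    consider "card J = 1" | "card J = 2" | "card J > 2"
    proof -
      have "card J \<noteq> 0" using False J by simp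
      then show thesis using that by linarith
    qed
    then show ?thesis
    proof cases
      case 1
      then obtain j where j: "J = {j}" by (auto simp: card_1_singleton_iff)
      have "e(j := f j) \<in> families"
        using e fA by (intro families_upd[OF nonzero_families_subset])
      then show ?thesis using normal_form_aI x j by simp
    next
      case 2
      then obtain i l where il: "J = {i, l}" "i \<noteq> l" by (auto simp: card_2_iff)
      let ?a = "e(i := f i)" and ?b = "e(l := f l)"
      have ab: "?a \<in> nonzero_families" "?b \<in> nonzero_families"
        using e fA f0 il J by (auto intro!: nonzero_families_upd)
      \<comment> \<open>In slot \<open>i\<close> the family \<open>?b\<close> has \<open>e i\<close>
        and \<open>?a\<close> has \<open>f i\<close>, so here independence is required with the
        roles exchanged.\<close>
      have "e i \<notin> span {f i}"
      proof
        assume "e i \<in> span {f i}"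
        then obtain c where c: "e i = s c (f i)" by (auto simp: span_singleton)
        then have "c \<noteq> 0" using eA[of i] il J by auto
        with c have "f i = s (1 / c) (e i)" by simp
        then have "f i \<in> span {e i}" by (auto simp: span_singleton)
        with find il show False by blast
      qed
      then have "{i, l} \<subseteq> {i\<in>{1..n}. ?b i \<notin> span {?a i}}"
        using il J find by auto
      then have "card {i, l} \<le> card {i\<in>{1..n}. ?b i \<notin> span {?a i}}"
        by (intro card_mono) auto
      then have "2 \<le> card {i\<in>{1..n}. ?b i \<notin> span {?a i}}" using il(2) by simp
      moreover have "x = T ?a + T ?b" using x(1) il by simp
      ultimately have "normal_form_b s A n x"
        unfolding normal_form_b_iff using ab by blast
      then show ?thesis by blast
    next
      case 3
      \<comment> \<open>\<open>normal_form_c\<close> asks for nonzero vectors in all slots, so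
        \<open>e j\<close> fills the slots outside \<open>J\<close>.\<close>
      define g where "g j = (if j \<in> J then f j else e j)" for j
      have xg: "x = (\<Sum>j\<in>J. T (e(j := g j)))"
        unfolding x(1) by (rule sum.cong) (auto simp: g_def)
      have "\<forall>j\<in>{1..n}. e j \<in> A j \<and> e j \<noteq> 0 \<and> g j \<in> A j \<and> g j \<noteq> 0" "\<forall>j\<in>J. g j \<notin> span {e j}"
        using eA fA f0 find by (auto simp: g_def)
      with 3 J(2) xg have "normal_form_c s A n J x"
        unfolding normal_form_c_def by blast
      then show ?thesis by blast
    qed
  qed
qed

end

section \<open>Limits of combinations of two decomposable tensors\<close>

context tensor_factors
begin

text \<open>Both families tend to \<open>e\<close>, and \<open>l\<close>, \<open>m\<close> may
  diverge. In \<open>(l + m) * T a + m * (T b - T a)\<close> the normalisation makes the two parts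
  converge separately, the second one to a tangent vector. The condition
  \<open>\<phi> j (y j) = 0\<close> serves to make \<open>y j\<close> zero or independent of
  \<open>e j\<close>.\<close>

lemma tangent_limit:
  assumes G: "G \<noteq> bot" and \<phi>: "\<phi> \<in> dual_families"
    and ab: "\<And>t. a t \<in> families" "\<And>t. b t \<in> families"
    and lim_a: "\<And>j. j \<in> {1..n} \<Longrightarrow> weak_tendsto j (\<lambda>t. a t j) (e j) G"
    and lim_b: "\<And>j. j \<in> {1..n} \<Longrightarrow> weak_tendsto j (\<lambda>t. b t j) (e j) G"
    and normalised: "eventually (\<lambda>t. \<forall>j\<in>{1..n}. \<phi> j (a t j) = 1 \<and> \<phi> j (b t j) = 1) G"
    and lim: "\<And>\<beta>. ((\<lambda>t. l t * T (a t) \<beta> + m t * T (b t) \<beta>) \<longlongrightarrow> x \<beta>) G"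
  shows "\<exists>y. (\<forall>j\<in>{1..n}. y j \<in> A j \<and> \<phi> j (y j) = 0) \<and>
    x = cscale (x \<phi>) (T e) + (\<Sum>j=1..n. T (e(j := y j)))"
proof -
  have A: "a t j \<in> A j" "b t j \<in> A j" if "j \<in> {1..n}" for t j
    using ab that by (auto simp: families_def)
  \<comment> \<open>At \<open>\<phi>\<close> all factors are eventually 1, so the combination
    reduces to \<open>l + m\<close>.\<close>
  have lm: "((\<lambda>t. l t + m t) \<longlongrightarrow> x \<phi>) G"
  proof (rule Lim_transform_eventually[OF lim])
    show "eventually (\<lambda>t. l t * T (a t) \<phi> + m t * T (b t) \<phi> = l t + m t) G"
      using normalised by (rule eventually_mono) (simp add: tensor_apply[OF \<phi>])
  qed
  \<comment> \<open>\<open>m t\<close> may blow up while \<open>b t j - a t j\<close> tends weakly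
    to 0; what converges is the product.\<close>
  define d where "d j t = s (m t) (b t j - a t j)" for j t
  have dA: "d j t \<in> A j" if "j \<in> {1..n}" for j t
    unfolding d_def using A that by (intro A_scale A_diff)
  have d_apply: "\<beta> (d j t) = m t * (\<beta> (b t j) - \<beta> (a t j))"
    if "j \<in> {1..n}" "\<beta> \<in> dual_space s (A j)" for j \<beta> t
  proof -
    have "\<beta> (b t j) = \<beta> (b t j - a t j) + \<beta> (a t j)"
      using dual_space_add[OF that(2), of "b t j - a t j" "a t j"] A[OF that(1)] A_diff[OF that(1)]
      by simp
    then show ?thesis
      unfolding d_def using A[OF that(1)] A_diff[OF that(1)] dual_space_scale[OF that(2)] by simp
  qed
  have "\<exists>v\<in>A j. weak_tendsto j (d j) v G" if j: "j \<in> {1..n}" for j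
  proof (rule weak_tendsto_exists[OF j dA[OF j]])
    fix \<beta> assume \<beta>: "\<beta> \<in> dual_space s (A j)"
    let ?\<beta> = "\<phi>(j := \<beta>)"
    have fam: "?\<beta> \<in> dual_families" using \<phi> \<beta> by (auto simp: dual_families_def)
    have slot: "T c ?\<beta> = \<beta> (c j)" if "\<forall>j\<in>{1..n}. \<phi> j (c j) = 1" for c
    proof -
      have "(\<Prod>i\<in>{1..n}-{j}. ?\<beta> i (c i)) = 1" using that by (intro prod.neutral) auto
      then show ?thesis using tensor_apply_slot[OF fam j, of c] by simp
    qed
    \<comment> \<open>Contracting every slot but \<open>j\<close> with \<open>\<phi>\<close> leaves
      \<open>l t * \<beta> (a t j) + m t * \<beta> (b t j)\<close>; subtracting
      \<open>(l t + m t) * \<beta> (a t j)\<close> isolates \<open>\<beta> (d j t)\<close>.\<close>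
    have "((\<lambda>t. l t * T (a t) ?\<beta> + m t * T (b t) ?\<beta> - (l t + m t) * \<beta> (a t j)) \<longlongrightarrow>
        x ?\<beta> - x \<phi> * \<beta> (e j)) G"
      using lim_a[OF j] \<beta> by (intro tendsto_intros lim lm) (auto simp: weak_tendsto_def)
    moreover have "eventually (\<lambda>t. l t * T (a t) ?\<beta> + m t * T (b t) ?\<beta> - (l t + m t) * \<beta> (a t j) = \<beta> (d j t)) G"
      using normalised by (rule eventually_mono) (auto simp: slot d_apply[OF j \<beta>] algebra_simps)
    ultimately show "\<exists>l. ((\<lambda>t. \<beta> (d j t)) \<longlongrightarrow> l) G"
      by (blast intro: Lim_transform_eventually)
  qed
  then obtain y where y: "\<And>j. j \<in> {1..n} \<Longrightarrow> y j \<in> A j \<and> weak_tendsto j (d j) (y j) G"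
    by metis
  have "\<phi> j (y j) = 0" if j: "j \<in> {1..n}" for j
  proof -
    have "((\<lambda>t. \<phi> j (d j t)) \<longlongrightarrow> \<phi> j (y j)) G"
      using y[OF j] dual_familiesD[OF \<phi> j] by (auto simp: weak_tendsto_def)
    moreover have "eventually (\<lambda>t. \<phi> j (d j t) = 0) G"
      using normalised by (rule eventually_mono) (use j in \<open>auto simp: d_apply[OF j dual_familiesD[OF \<phi> j]]\<close>)
    ultimately have "((\<lambda>t. 0) \<longlongrightarrow> \<phi> j (y j)) G"
      by (rule Lim_transform_eventually)
    then show ?thesis using G by (simp add: tendsto_const_iff)
  qed
  moreover have "x = cscale (x \<phi>) (T e) + (\<Sum>j=1..n. T (e(j := y j)))"
  proof (rule tensor_eqI)
    fix \<beta> assume \<beta>: "\<beta> \<notin> dual_families"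
    then have "((\<lambda>t. 0) \<longlongrightarrow> x \<beta>) G" using lim[of \<beta>] by (simp add: tensor_outside)
    then have "x \<beta> = 0" using G by (simp add: tendsto_const_iff)
    then show "x \<beta> = (cscale (x \<phi>) (T e) + (\<Sum>j=1..n. T (e(j := y j)))) \<beta>"
      using \<beta> by (simp add: cscale_def sum_fun_apply tensor_outside)
  next
    fix \<beta> assume \<beta>: "\<beta> \<in> dual_families"
    have lims: "((\<lambda>t. \<beta> j (a t j)) \<longlongrightarrow> \<beta> j (e j)) G" "((\<lambda>t. \<beta> j (b t j)) \<longlongrightarrow> \<beta> j (e j)) G"
      "((\<lambda>t. \<beta> j (d j t)) \<longlongrightarrow> \<beta> j (y j)) G" if j: "j \<in> {1..n}" for j
      using lim_a[OF j] lim_b[OF j] y[OF j] dual_familiesD[OF \<beta> j] by (auto simp: weak_tendsto_def)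
    let ?S = "\<lambda>t. \<Sum>j=1..n. \<beta> j (d j t) *
      ((\<Prod>i\<in>{1..<j}. \<beta> i (b t i)) * (\<Prod>i\<in>{j<..n}. \<beta> i (a t i)))"
    \<comment> \<open>Telescoping distributes the factor \<open>m t\<close> so that it occurs only
      inside the convergent \<open>d j t\<close>.\<close>
    have diff: "m t * (T (b t) \<beta> - T (a t) \<beta>) = ?S t" for t
    proof -
      have "m t * (T (b t) \<beta> - T (a t) \<beta>) = (\<Sum>j=1..n. m t * ((\<beta> j (b t j) - \<beta> j (a t j)) *
          ((\<Prod>i\<in>{1..<j}. \<beta> i (b t i)) * (\<Prod>i\<in>{j<..n}. \<beta> i (a t i)))))"
        unfolding tensor_apply[OF \<beta>] prod_diff_telescope sum_distrib_left ..
      also have "\<dots> = ?S t"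
        by (rule sum.cong) (auto simp: d_apply dual_familiesD[OF \<beta>])
      finally show ?thesis .
    qed
    have "(?S \<longlongrightarrow> (\<Sum>j=1..n. \<beta> j (y j) *
      ((\<Prod>i\<in>{1..<j}. \<beta> i (e i)) * (\<Prod>i\<in>{j<..n}. \<beta> i (e i))))) G"
      by (intro tendsto_sum tendsto_mult tendsto_prod lims) auto
    also have "(\<Sum>j=1..n. \<beta> j (y j) * ((\<Prod>i\<in>{1..<j}. \<beta> i (e i)) * (\<Prod>i\<in>{j<..n}. \<beta> i (e i)))) =
      (\<Sum>j=1..n. T (e(j := y j)) \<beta>)"
    proof (rule sum.cong)
      fix j assume j: "j \<in> {1..n}"
      have "(\<Prod>i\<in>{1..n}-{j}. \<beta> i (e i)) = (\<Prod>i\<in>{1..<j} \<union> {j<..n}. \<beta> i (e i))"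
        using j by (intro prod.cong) auto
      also have "\<dots> = (\<Prod>i\<in>{1..<j}. \<beta> i (e i)) * (\<Prod>i\<in>{j<..n}. \<beta> i (e i))"
        by (rule prod.union_disjoint) auto
      finally show "\<beta> j (y j) * ((\<Prod>i\<in>{1..<j}. \<beta> i (e i)) * (\<Prod>i\<in>{j<..n}. \<beta> i (e i))) = T (e(j := y j)) \<beta>"
        by (simp add: tensor_apply_upd[OF \<beta> j])
    qed simp
    finally have S: "(?S \<longlongrightarrow> (\<Sum>j=1..n. T (e(j := y j)) \<beta>)) G" .
    have "((\<lambda>t. (l t + m t) * T (a t) \<beta> + ?S t) \<longlongrightarrow> x \<phi> * T e \<beta> + (\<Sum>j=1..n. T (e(j := y j)) \<beta>)) G"
      by (intro tendsto_add tendsto_mult lm S tensor_tendsto lim_a)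
    moreover have "(\<lambda>t. (l t + m t) * T (a t) \<beta> + ?S t) = (\<lambda>t. l t * T (a t) \<beta> + m t * T (b t) \<beta>)"
      unfolding diff[symmetric] by (auto simp: algebra_simps)
    ultimately have "((\<lambda>t. l t * T (a t) \<beta> + m t * T (b t) \<beta>) \<longlongrightarrow>
        x \<phi> * T e \<beta> + (\<Sum>j=1..n. T (e(j := y j)) \<beta>)) G"
      by (simp only:)
    then have "x \<beta> = x \<phi> * T e \<beta> + (\<Sum>j=1..n. T (e(j := y j)) \<beta>)"
      by (rule tendsto_unique[OF G lim])
    then show "x \<beta> = (cscale (x \<phi>) (T e) + (\<Sum>j=1..n. T (e(j := y j)))) \<beta>"
      by (simp add: cscale_def sum_fun_apply)
  qed
  ultimately show ?thesis using y by blast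
qed

text \<open>In slot \<open>i\<close> the functionals dual to \<open>a0 i\<close>,
  \<open>b0 i\<close> give two evaluations whose coefficient matrix tends to a diagonal matrix with
  nonzero diagonal, so both coefficients converge by Cramer's rule.\<close>

lemma combination_limit_of_independent:
  assumes G: "G \<noteq> bot"
    and ab: "a0 \<in> nonzero_families" "b0 \<in> nonzero_families"
    and lim_a: "\<And>j. j \<in> {1..n} \<Longrightarrow> weak_tendsto j (\<lambda>t. a t j) (a0 j) G"
    and lim_b: "\<And>j. j \<in> {1..n} \<Longrightarrow> weak_tendsto j (\<lambda>t. b t j) (b0 j) G"
    and i: "i \<in> {1..n}" "b0 i \<notin> span {a0 i}"
    and lim: "\<And>\<beta>. ((\<lambda>t. l t * T (a t) \<beta> + m t * T (b t) \<beta>) \<longlongrightarrow> x \<beta>) G"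
  shows "\<exists>l0 m0. x = cscale l0 (T a0) + cscale m0 (T b0)"
proof -
  have nz: "a0 j \<in> A j" "b0 j \<in> A j" "a0 j \<noteq> 0" "b0 j \<noteq> 0" if "j \<in> {1..n}" for j
    using ab that by (auto simp: nonzero_families_def)
  have "\<exists>\<theta>. \<theta> \<in> dual_space s (A j) \<and> \<theta> (a0 j) \<noteq> 0 \<and> \<theta> (b0 j) \<noteq> 0" if "j \<in> {1..n}" for j
    by (rule functional_nonzero_on_two[OF nz[OF that]]) blast
  then obtain \<theta> where \<theta>: "\<And>j. j \<in> {1..n} \<Longrightarrow> \<theta> j \<in> dual_space s (A j) \<and> \<theta> j (a0 j) \<noteq> 0 \<and> \<theta> j (b0 j) \<noteq> 0"
    by metis
  obtain \<phi> where \<phi>: "\<phi> \<in> dual_space s (A i)" "\<phi> (a0 i) = 1" "\<phi> (b0 i) = 0"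
    using functional_on_pair[OF nz(3)[OF i(1)] i(2)] .
  obtain \<psi> where \<psi>: "\<psi> \<in> dual_space s (A i)" "\<psi> (a0 i) = 0" "\<psi> (b0 i) = 1"
    using functional_on_pair[OF nz(3)[OF i(1)] i(2)] .
  have eval: "T c (\<theta>(i := \<gamma>)) = \<gamma> (c i) * (\<Prod>j\<in>{1..n}-{i}. \<theta> j (c j))"
    if "\<gamma> \<in> dual_space s (A i)" for \<gamma> c
  proof -
    have "\<theta>(i := \<gamma>) \<in> dual_families" using that \<theta> by (auto simp: dual_families_def)
    moreover have "(\<Prod>j\<in>{1..n}-{i}. (\<theta>(i := \<gamma>)) j (c j)) = (\<Prod>j\<in>{1..n}-{i}. \<theta> j (c j))"
      by (rule prod.cong) auto
    ultimately show ?thesis using tensor_apply_slot[OF _ i(1)] by simp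
  qed
  have P: "T a0 (\<theta>(i := \<phi>)) \<noteq> 0" "T b0 (\<theta>(i := \<psi>)) \<noteq> 0"
    using \<theta> by (auto simp: eval \<phi> \<psi>)
  have Z: "T b0 (\<theta>(i := \<phi>)) = 0" "T a0 (\<theta>(i := \<psi>)) = 0"
    by (auto simp: eval \<phi> \<psi>)
  have ta: "((\<lambda>t. T (a t) \<beta>) \<longlongrightarrow> T a0 \<beta>) G" and tb: "((\<lambda>t. T (b t) \<beta>) \<longlongrightarrow> T b0 \<beta>) G" for \<beta>
    by (rule tensor_tendsto, fact lim_a, rule tensor_tendsto, fact lim_b)
  note l = ta[of "\<theta>(i := \<phi>)"] tb[of "\<theta>(i := \<phi>)"] ta[of "\<theta>(i := \<psi>)"] tb[of "\<theta>(i := \<psi>)"]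
  obtain l0 where l0: "(l \<longlongrightarrow> l0) G"
    using cramer_tendsto[OF l(1) l(2)[unfolded Z] l(3)[unfolded Z] l(4) P lim lim] by blast
  \<comment> \<open>Exchanging the two families and the two coefficients gives the system for
    \<open>m\<close>.\<close>
  have lim': "((\<lambda>t. m t * T (b t) \<beta> + l t * T (a t) \<beta>) \<longlongrightarrow> x \<beta>) G" for \<beta>
    using lim[of \<beta>] by (simp add: add.commute)
  obtain m0 where m0: "(m \<longlongrightarrow> m0) G"
    using cramer_tendsto[OF l(4) l(3)[unfolded Z] l(2)[unfolded Z] l(1) P(2) P(1) lim' lim'] by blast
  have "x \<beta> = l0 * T a0 \<beta> + m0 * T b0 \<beta>" for \<beta>
    by (rule tendsto_unique[OF G lim]) (intro tendsto_intros l0 m0 ta tb)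
  then show ?thesis
    by (intro exI[of _ l0] exI[of _ m0]) (simp add: fun_eq_iff cscale_def)
qed

lemma weak_tendsto_normalise:
  assumes j: "j \<in> {1..n}" and \<phi>: "\<phi> \<in> dual_space s (A j)" "\<phi> v0 \<noteq> 0"
    and v: "\<And>t. v t \<in> A j" "v0 \<in> A j" and lim: "weak_tendsto j v v0 F"
  shows "weak_tendsto j (\<lambda>t. s (1 / \<phi> (v t)) (v t)) (s (1 / \<phi> v0) v0) F"
  unfolding weak_tendsto_def
proof
  fix \<beta> assume \<beta>: "\<beta> \<in> dual_space s (A j)"
  have "((\<lambda>t. 1 / \<phi> (v t) * \<beta> (v t)) \<longlongrightarrow> 1 / \<phi> v0 * \<beta> v0) F"
    using lim \<phi> \<beta> by (intro tendsto_intros) (auto simp: weak_tendsto_def)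
  then show "((\<lambda>t. \<beta> (s (1 / \<phi> (v t)) (v t))) \<longlongrightarrow> \<beta> (s (1 / \<phi> v0) v0)) F"
    unfolding dual_space_scale[OF \<beta> v(1)] dual_space_scale[OF \<beta> v(2)] .
qed

text \<open>If some limit directions differ, the limit is a combination of \<open>T a0\<close> and
  \<open>T b0\<close>. Otherwise both families, normalised by functionals with value 1 on
  \<open>a0 j\<close>, tend to \<open>a0\<close>, and the tangent case applies.\<close>

lemma normal_form_of_limit:
  fixes a b :: "'t \<Rightarrow> nat \<Rightarrow> 'v"
  assumes G: "G \<noteq> bot"
    and ab: "\<And>t. a t \<in> families" "\<And>t. b t \<in> families"
    and ab0: "a0 \<in> nonzero_families" "b0 \<in> nonzero_families"
    and lim_a: "\<And>j. j \<in> {1..n} \<Longrightarrow> weak_tendsto j (\<lambda>t. a t j) (a0 j) G"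
    and lim_b: "\<And>j. j \<in> {1..n} \<Longrightarrow> weak_tendsto j (\<lambda>t. b t j) (b0 j) G"
    and lim: "\<And>\<beta>. ((\<lambda>t. l t * T (a t) \<beta> + m t * T (b t) \<beta>) \<longlongrightarrow> x \<beta>) G"
    and x: "x \<noteq> 0"
  shows "normal_form_a s A n x \<or> normal_form_b s A n x \<or> (\<exists>J. normal_form_c s A n J x)"
proof (cases "\<exists>i\<in>{1..n}. b0 i \<notin> span {a0 i}")
  case True
  then obtain i where i: "i \<in> {1..n}" "b0 i \<notin> span {a0 i}" by blast
  obtain l0 m0 where "x = cscale l0 (T a0) + cscale m0 (T b0)"
    using combination_limit_of_independent[OF G ab0 lim_a lim_b i lim] by blast
  then show ?thesis using normal_form_combination_of_two[OF ab0 _ x] by blast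
next
  case False
  have A: "a t j \<in> A j" "b t j \<in> A j" if "j \<in> {1..n}" for t j
    using ab that by (auto simp: families_def)
  have nz: "a0 j \<in> A j" "b0 j \<in> A j" "a0 j \<noteq> 0" "b0 j \<noteq> 0" if "j \<in> {1..n}" for j
    using ab0 that by (auto simp: nonzero_families_def)
  have "\<exists>k. b0 j = s k (a0 j)" if "j \<in> {1..n}" for j
    using False that by (auto simp: span_singleton)
  then obtain k where k: "\<And>j. j \<in> {1..n} \<Longrightarrow> b0 j = s (k j) (a0 j)" by metis
  have k0: "k j \<noteq> 0" if "j \<in> {1..n}" for j using k[OF that] nz(4)[OF that] by auto
  have "\<exists>\<phi>. \<phi> \<in> dual_space s (A j) \<and> \<phi> (a0 j) = 1" if "j \<in> {1..n}" for j
    by (rule functional_on_vector[OF nz(3)[OF that]]) blast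
  then obtain \<phi> where \<phi>: "\<And>j. j \<in> {1..n} \<Longrightarrow> \<phi> j \<in> dual_space s (A j)" "\<And>j. j \<in> {1..n} \<Longrightarrow> \<phi> j (a0 j) = 1"
    by metis
  have \<phi>b: "\<phi> j (b0 j) = k j" if "j \<in> {1..n}" for j
    using that nz(1)[OF that] by (simp add: k \<phi> dual_space_scale[OF \<phi>(1)])
  have \<phi>fam: "\<phi> \<in> dual_families" using \<phi> by (auto simp: dual_families_def)
  \<comment> \<open>Where \<open>\<phi> j (a t j) = 0\<close>, the quotient is 0 and the vector
    becomes 0, which still lies in \<open>A j\<close>; by \<open>ev\<close> this eventually
    stops.\<close>
  define a' where "a' t j = s (1 / \<phi> j (a t j)) (a t j)" for t j
  define b' where "b' t j = s (1 / \<phi> j (b t j)) (b t j)" for t j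
  have fam': "a' t \<in> families" "b' t \<in> families" for t
    using A by (auto simp: families_def a'_def b'_def A_scale)
  have lim_a': "weak_tendsto j (\<lambda>t. a' t j) (a0 j) G" if j: "j \<in> {1..n}" for j
    using weak_tendsto_normalise[OF j \<phi>(1)[OF j] _ _ _ lim_a[OF j]] A nz j
    by (simp add: a'_def \<phi>)
  \<comment> \<open>Since \<open>b0 j\<close> is \<open>k j\<close> times \<open>a0 j\<close> and
    \<open>\<phi> j (b0 j) = k j\<close>, the normalised limit is \<open>a0 j\<close> again.\<close>
  have lim_b': "weak_tendsto j (\<lambda>t. b' t j) (a0 j) G" if j: "j \<in> {1..n}" for j
    using weak_tendsto_normalise[OF j \<phi>(1)[OF j] _ _ _ lim_b[OF j]] A nz j k0
    by (simp add: b'_def \<phi>b) (simp add: k)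
  have ev: "eventually (\<lambda>t. \<forall>j\<in>{1..n}. \<phi> j (a t j) \<noteq> 0 \<and> \<phi> j (b t j) \<noteq> 0) G"
  proof -
    have "eventually (\<lambda>t. \<phi> j (a t j) \<noteq> 0) G" "eventually (\<lambda>t. \<phi> j (b t j) \<noteq> 0) G" if j: "j \<in> {1..n}" for j
    proof -
      show "eventually (\<lambda>t. \<phi> j (a t j) \<noteq> 0) G"
        using lim_a[OF j] \<phi>(1)[OF j] \<phi>(2)[OF j]
        by (intro tendsto_imp_eventually_ne[of _ "\<phi> j (a0 j)"]) (auto simp: weak_tendsto_def)
      show "eventually (\<lambda>t. \<phi> j (b t j) \<noteq> 0) G"
        using lim_b[OF j] \<phi>(1)[OF j] \<phi>b[OF j] k0[OF j]
        by (intro tendsto_imp_eventually_ne[of _ "\<phi> j (b0 j)"]) (auto simp: weak_tendsto_def)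
    qed
    then show ?thesis by (simp add: eventually_ball_finite_distrib eventually_conj_iff)
  qed
  have scaled: "(\<Prod>j=1..n. \<phi> j (c j)) * T (\<lambda>j. s (1 / \<phi> j (c j)) (c j)) \<beta> = T c \<beta>"
    if "\<forall>j\<in>{1..n}. \<phi> j (c j) \<noteq> 0" "c \<in> families" for c \<beta>
    using that by (subst tensor_scale_all) (auto simp: cscale_def prod_dividef)
  have "\<exists>y. (\<forall>j\<in>{1..n}. y j \<in> A j \<and> \<phi> j (y j) = 0) \<and>
    x = cscale (x \<phi>) (T a0) + (\<Sum>j=1..n. T (a0(j := y j)))"
  proof (rule tangent_limit[OF G \<phi>fam fam' lim_a' lim_b'])
    show "eventually (\<lambda>t. \<forall>j\<in>{1..n}. \<phi> j (a' t j) = 1 \<and> \<phi> j (b' t j) = 1) G"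
      using ev by (rule eventually_mono)
        (auto simp: a'_def b'_def dual_space_scale[OF \<phi>(1)] A)
    show "((\<lambda>t. l t * (\<Prod>j=1..n. \<phi> j (a t j)) * T (a' t) \<beta> + m t * (\<Prod>j=1..n. \<phi> j (b t j)) * T (b' t) \<beta>) \<longlongrightarrow> x \<beta>) G" for \<beta>
    proof (rule Lim_transform_eventually[OF lim])
      show "eventually (\<lambda>t. l t * T (a t) \<beta> + m t * T (b t) \<beta> =
        l t * (\<Prod>j=1..n. \<phi> j (a t j)) * T (a' t) \<beta> + m t * (\<Prod>j=1..n. \<phi> j (b t j)) * T (b' t) \<beta>) G"
        using ev
      proof (rule eventually_mono)
        fix t assume "\<forall>j\<in>{1..n}. \<phi> j (a t j) \<noteq> 0 \<and> \<phi> j (b t j) \<noteq> 0"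
        then show "l t * T (a t) \<beta> + m t * T (b t) \<beta> =
          l t * (\<Prod>j=1..n. \<phi> j (a t j)) * T (a' t) \<beta> + m t * (\<Prod>j=1..n. \<phi> j (b t j)) * T (b' t) \<beta>"
          using scaled[of "a t" \<beta>] scaled[of "b t" \<beta>] ab[of t]
          by (simp add: mult.assoc a'_def[abs_def] b'_def[abs_def])
      qed
    qed
  qed
  then obtain y where y: "\<And>j. j \<in> {1..n} \<Longrightarrow> y j \<in> A j \<and> \<phi> j (y j) = 0"
    and xy: "x = cscale (x \<phi>) (T a0) + (\<Sum>j=1..n. T (a0(j := y j)))" by blast
  show ?thesis
  \<comment> \<open>The kernel of \<open>\<phi> j\<close> meets the line of \<open>a0 j\<close> only
    in 0.\<close>
  proof (rule normal_form_tangent[OF ab0(1) _ _ xy x])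
    fix j assume j: "j \<in> {1..n}"
    show "y j \<in> A j" using y j by blast
    assume "y j \<in> span {a0 j}"
    then obtain c where c: "y j = s c (a0 j)" by (auto simp: span_singleton)
    then have "\<phi> j (y j) = c" using j nz(1) by (simp add: dual_space_scale[OF \<phi>(1)] \<phi>)
    then show "y j = 0" using c y[OF j] by simp
  qed
qed

text \<open>Two successive passages to finer filters, first for \<open>a\<close> and then for
  \<open>b\<close>, make the rescaled factors converge; dividing \<open>l\<close> and
  \<open>m\<close> by the products of the scalings compensates.\<close>

lemma normal_form_of_border_rank_two:
  assumes F: "F \<noteq> bot"
    and ab: "\<And>t. a t \<in> nonzero_families" "\<And>t. b t \<in> nonzero_families"
    and lim: "\<And>\<beta>. ((\<lambda>t. l t * T (a t) \<beta> + m t * T (b t) \<beta>) \<longlongrightarrow> x \<beta>) F"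
    and x: "x \<noteq> 0"
  shows "normal_form_a s A n x \<or> normal_form_b s A n x \<or> (\<exists>J. normal_form_c s A n J x)"
proof -
  obtain G c a0 where G: "G \<le> F" "G \<noteq> bot" and c: "\<And>t j. j \<in> {1..n} \<Longrightarrow> c t j \<noteq> 0"
    and a0: "a0 \<in> nonzero_families"
    and lim_a: "\<And>j. j \<in> {1..n} \<Longrightarrow> weak_tendsto j (\<lambda>t. s (c t j) (a t j)) (a0 j) G"
    by (rule normalised_directions_accumulate[of F a, OF F ab(1)]) (rule that)
  obtain H d b0 where H: "H \<le> G" "H \<noteq> bot" and d: "\<And>t j. j \<in> {1..n} \<Longrightarrow> d t j \<noteq> 0"
    and b0: "b0 \<in> nonzero_families"
    and lim_b: "\<And>j. j \<in> {1..n} \<Longrightarrow> weak_tendsto j (\<lambda>t. s (d t j) (b t j)) (b0 j) H"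
    by (rule normalised_directions_accumulate[of G b, OF G(2) ab(2)]) (rule that)
  have fam: "(\<lambda>j. s (c t j) (a t j)) \<in> families" "(\<lambda>j. s (d t j) (b t j)) \<in> families" for t
    using ab[of t] by (auto simp: families_def nonzero_families_def A_scale)
  have scaled: "k / (\<Prod>j=1..n. c j) * T (\<lambda>j. s (c j) (a j)) \<beta> = k * T a \<beta>"
    if "\<And>j. j \<in> {1..n} \<Longrightarrow> c j \<noteq> 0" "a \<in> nonzero_families" for k c a \<beta>
    using that by (subst tensor_scale_all) (auto simp: cscale_def nonzero_families_subset)
  show ?thesis
  proof (rule normal_form_of_limit[OF H(2) fam a0 b0 _ lim_b _ x])
    show "weak_tendsto j (\<lambda>t. s (c t j) (a t j)) (a0 j) H" if "j \<in> {1..n}" for j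
      using weak_tendsto_mono[OF lim_a[OF that] H(1)] .
    show "((\<lambda>t. l t / (\<Prod>j=1..n. c t j) * T (\<lambda>j. s (c t j) (a t j)) \<beta> +
        m t / (\<Prod>j=1..n. d t j) * T (\<lambda>j. s (d t j) (b t j)) \<beta>) \<longlongrightarrow> x \<beta>) H" for \<beta>
      using tendsto_mono[OF order_trans[OF H(1) G(1)] lim] by (simp only: scaled[OF c ab(1)] scaled[OF d ab(2)])
  qed
qed

end

section \<open>Points of the secant variety\<close>

lemma tendsto_applyI:
  fixes g :: "'t \<Rightarrow> 'i \<Rightarrow> 'b::topological_space"
  assumes "\<And>i. ((\<lambda>t. g t i) \<longlongrightarrow> g0 i) F"
  shows "(g \<longlongrightarrow> g0) F"
proof -
  have "limitin (product_topology (\<lambda>i. euclidean) UNIV) g g0 F"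
    using assms by (simp add: limitin_componentwise)
  then show ?thesis by (simp add: euclidean_product_topology)
qed

lemma in_fct_span_pair: "v \<in> fct.span {p, q} \<longleftrightarrow> (\<exists>k l. v = cscale k p + cscale l q)"
proof -
  have "v \<in> fct.span {p, q} \<longleftrightarrow> (\<exists>k l. v - cscale k p = cscale l q)"
    by (auto simp: fct.span_breakdown_eq[of v p "{q}"] fct.span_singleton)
  also have "\<dots> \<longleftrightarrow> (\<exists>k l. v = cscale k p + cscale l q)"
    by (simp add: algebra_simps)
  finally show ?thesis .
qed

lemma fct_span_span_Un: "fct.span (fct.span S \<union> fct.span R) = fct.span (S \<union> R)"
proof
  show "fct.span (fct.span S \<union> fct.span R) \<subseteq> fct.span (S \<union> R)"
    by (intro fct.span_minimal fct.subspace_span Un_least fct.span_mono) auto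
  show "fct.span (S \<union> R) \<subseteq> fct.span (fct.span S \<union> fct.span R)"
    by (intro fct.span_mono Un_mono fct.span_superset)
qed

context tensor_factors
begin

text \<open>A point of the limiting plane is a limit of points \<open>z t\<close> of the moving
  planes, and near 0 each \<open>z t\<close> is a combination of decomposable tensors representing
  the two curves.\<close>

lemma normal_form_of_secant_variety:
  assumes x: "x \<in> affine_cone (secant_variety (tensor_space s A n) (segre s A n))" "x \<noteq> 0"
  shows "normal_form_a s A n x \<or> normal_form_b s A n x \<or> (\<exists>J. normal_form_c s A n J x)"
proof -
  obtain x1 x2 L where curves: "curve_in (segre s A n) x1" "curve_in (segre s A n) x2"
    and L: "plane_tendsto (\<lambda>t. fct.span (x1 t \<union> x2 t)) L (at 0)" "fct.span {x} \<subseteq> L"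
    using x unfolding affine_cone_def secant_variety_def by auto
  have ev: "eventually (\<lambda>t. y t \<in> segre s A n) (at 0)" if "curve_in (segre s A n) y" for y
  proof -
    from that[unfolded curve_in_def] obtain \<epsilon> y'
      where \<epsilon>: "\<epsilon> > 0" "\<forall>t\<in>ball 0 \<epsilon>. y t \<in> segre s A n \<and> y' t \<noteq> 0 \<and> y t = fct.span {y' t}"
      by (elim exE conjE)
    have "y t \<in> segre s A n" if "dist t 0 < \<epsilon>" for t
    proof -
      have "t \<in> ball 0 \<epsilon>" using that by simp
      with \<epsilon>(2) show ?thesis by blast
    qed
    with \<epsilon>(1) show ?thesis unfolding eventually_at by blast
  qed
  obtain u w u0 w0 where
    uw: "eventually (\<lambda>t. fct.span (x1 t \<union> x2 t) = fct.span {u t, w t}) (at 0)"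
    and lim: "(u \<longlongrightarrow> u0) (at 0)" "(w \<longlongrightarrow> w0) (at 0)" and L0: "L = fct.span {u0, w0}"
    using L(1) unfolding plane_tendsto_def by blast
  have "x \<in> fct.span {u0, w0}" using L(2) L0 fct.span_base[of x "{x}"] by auto
  then obtain p q where xpq: "x = cscale p u0 + cscale q w0" by (auto simp: in_fct_span_pair)
  define z where "z t = cscale p (u t) + cscale q (w t)" for t
  have z_lim: "((\<lambda>t. z t \<beta>) \<longlongrightarrow> x \<beta>) (at 0)" for \<beta>
  proof -
    have "((\<lambda>t. p * u t \<beta> + q * w t \<beta>) \<longlongrightarrow> p * u0 \<beta> + q * w0 \<beta>) (at 0)"
      by (intro tendsto_add tendsto_mult_left tendsto_apply[OF lim(1)] tendsto_apply[OF lim(2)])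
    then show ?thesis by (simp add: z_def xpq cscale_def)
  qed
  \<comment> \<open>This allows \<open>rep\<close> to be total, with an arbitrary nonzero family as
    value outside the Segre variety.\<close>
  have "nonzero_families \<noteq> {}"
    using eventually_happens[OF ev[OF curves(1)]] by (auto simp: segre_eq)
  then have "\<exists>a. a \<in> nonzero_families \<and> (y \<in> segre s A n \<longrightarrow> y = fct.span {T a})" for y
    by (auto simp: segre_eq)
  then obtain rep where rep: "\<And>y. rep y \<in> nonzero_families"
    "\<And>y. y \<in> segre s A n \<Longrightarrow> y = fct.span {T (rep y)}" by metis
  define a where "a t = rep (x1 t)" for t
  define b where "b t = rep (x2 t)" for t
  have ev_span: "eventually (\<lambda>t. \<exists>l m. z t = cscale l (T (a t)) + cscale m (T (b t))) (at 0)"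
    using uw ev[OF curves(1)] ev[OF curves(2)]
  proof eventually_elim
    case (elim t)
    have "fct.span {u t, w t} = fct.span (fct.span {T (a t)} \<union> fct.span {T (b t)})"
      using elim(1) rep(2)[OF elim(2)] rep(2)[OF elim(3)] by (simp add: a_def b_def)
    also have "\<dots> = fct.span {T (a t), T (b t)}"
      by (simp add: fct_span_span_Un insert_commute)
    finally have "z t \<in> fct.span {T (a t), T (b t)}"
      unfolding z_def using in_fct_span_pair by blast
    then show ?case by (simp add: in_fct_span_pair)
  qed
  \<comment> \<open>The coefficients are chosen pointwise as a pair. Where no pair exists the choice
    is arbitrary; by \<open>ev_span\<close> this does not occur for \<open>t \<noteq> 0\<close> near
    0.\<close>
  define P where "P t k \<longleftrightarrow> z t = cscale (fst k) (T (a t)) + cscale (snd k) (T (b t))" for t k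
  define l where "l t = fst (SOME k. P t k)" for t
  define m where "m t = snd (SOME k. P t k)" for t
  have lm: "z t = cscale (l t) (T (a t)) + cscale (m t) (T (b t))"
    if "\<exists>l m. z t = cscale l (T (a t)) + cscale m (T (b t))" for t
  proof -
    have "\<exists>k. P t k" using that by (auto simp: P_def)
    from someI_ex[OF this] show ?thesis by (simp add: P_def l_def m_def)
  qed
  show ?thesis
  proof (rule normal_form_of_border_rank_two[of "at 0 :: complex filter" a b l m, OF _ _ _ _ x(2)])
    show "((\<lambda>t. l t * T (a t) \<beta> + m t * T (b t) \<beta>) \<longlongrightarrow> x \<beta>) (at 0)" for \<beta>
    proof (rule Lim_transform_eventually[OF z_lim])
      show "eventually (\<lambda>t. z t \<beta> = l t * T (a t) \<beta> + m t * T (b t) \<beta>) (at 0)"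
        using ev_span
      proof (rule eventually_mono)
        fix t assume "\<exists>l m. z t = cscale l (T (a t)) + cscale m (T (b t))"
        from lm[OF this] show "z t \<beta> = l t * T (a t) \<beta> + m t * T (b t) \<beta>"
          by (simp add: cscale_def)
      qed
    qed
  qed (auto simp: a_def b_def rep)
qed

text \<open>The tensor \<open>x\<close> is the derivative at 0 of the curve with factors
  \<open>e j + t f j\<close> for \<open>j\<close> in \<open>J\<close> and \<open>e j\<close>
  elsewhere, so it lies in the limit of the secant lines joining \<open>T e\<close> to this
  curve.\<close>

lemma tangent_sum_in_secant_variety:
  assumes e: "e \<in> nonzero_families" and f: "f \<in> families"
    and ind: "\<And>j. j \<in> {1..n} \<Longrightarrow> f j \<notin> span {e j}"
    and J: "J \<subseteq> {1..n}" "J \<noteq> {}"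
  defines "x \<equiv> \<Sum>j\<in>J. T (e(j := f j))"
  shows "x \<in> affine_cone (secant_variety (tensor_space s A n) (segre s A n))" "x \<noteq> 0"
proof -
  have A: "e j \<in> A j" "f j \<in> A j" "e j \<noteq> 0" if "j \<in> {1..n}" for j
    using e f that by (auto simp: nonzero_families_def families_def)
  have fin: "finite J" using J finite_subset by blast
  \<comment> \<open>These functionals separate \<open>T e\<close> from \<open>x\<close> and keep the
    curve away from 0; changing slot \<open>j0\<close> to \<open>\<psi>\<close> detects
    \<open>x\<close>.\<close>
  have "\<exists>\<phi>. \<phi> \<in> dual_space s (A j) \<and> \<phi> (e j) = 1 \<and> \<phi> (f j) = 0" if "j \<in> {1..n}" for j
    by (rule functional_on_pair[OF A(3)[OF that] ind[OF that], where p=1 and q=0]) blast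
  then obtain \<phi> where \<phi>: "\<And>j. j \<in> {1..n} \<Longrightarrow> \<phi> j \<in> dual_space s (A j)"
    "\<And>j. j \<in> {1..n} \<Longrightarrow> \<phi> j (e j) = 1" "\<And>j. j \<in> {1..n} \<Longrightarrow> \<phi> j (f j) = 0" by metis
  obtain j0 where j0: "j0 \<in> J" "j0 \<in> {1..n}" using J by blast
  obtain \<psi> where \<psi>: "\<psi> \<in> dual_space s (A j0)" "\<psi> (e j0) = 0" "\<psi> (f j0) = 1"
    using functional_on_pair[OF A(3)[OF j0(2)] ind[OF j0(2)]] .
  have fam: "\<phi> \<in> dual_families" "\<phi>(j0 := \<psi>) \<in> dual_families"
    using \<phi> \<psi> by (auto simp: dual_families_def)
  have Te: "T e \<phi> = 1" "T e (\<phi>(j0 := \<psi>)) = 0"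
    using \<phi> \<psi> by (auto simp: tensor_apply[OF fam(1)] tensor_apply_slot[OF fam(2) j0(2)])
  have x_apply: "x \<beta> = (\<Sum>j\<in>J. T (e(j := f j)) \<beta>)" for \<beta> unfolding x_def by (simp add: sum_fun_apply)
  have "x \<phi> = 0"
    unfolding x_apply using J \<phi> by (intro sum.neutral) (auto simp: tensor_apply_upd[OF fam(1)])
  moreover have "x (\<phi>(j0 := \<psi>)) = 1"
  proof -
    have "T (e(j := f j)) (\<phi>(j0 := \<psi>)) = (if j = j0 then 1 else 0)" if "j \<in> J" for j
    proof (cases "j = j0")
      case True
      then show ?thesis using \<phi> \<psi> j0 by (simp add: tensor_apply_upd[OF fam(2)])
    next
      case False
      then show ?thesis using \<psi> by (simp add: tensor_apply_slot[OF fam(2) j0(2)])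
    qed
    then show ?thesis unfolding x_apply using j0 fin by simp
  qed
  ultimately have x: "x \<phi> = 0" "x (\<phi>(j0 := \<psi>)) = 1" by auto
  then show x0: "x \<noteq> 0" by auto
  define g where "g t j = (if j \<in> J then e j + s t (f j) else e j)" for t j
  have gA: "g t j \<in> A j" if "j \<in> {1..n}" for t j
    using A[OF that] that by (auto simp: g_def A_add A_scale)
  have g_apply: "\<beta> (g t j) = \<beta> (e j) + t * (if j \<in> J then \<beta> (f j) else 0)"
    if "j \<in> {1..n}" "\<beta> \<in> dual_space s (A j)" for \<beta> t j
    using A[OF that(1)] that(1)
    by (simp add: g_def dual_space_add[OF that(2)] dual_space_scale[OF that(2)] A_scale)
  \<comment> \<open>For every \<open>t\<close> the functional \<open>\<phi> j\<close> has value 1 on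
    \<open>g t j\<close>, so the lift vanishes nowhere.\<close>
  have "g t j \<noteq> 0" if j: "j \<in> {1..n}" for t j
  proof
    assume "g t j = 0"
    then have "\<phi> j 0 = 1" using g_apply[OF j \<phi>(1)[OF j], of t] \<phi> j by simp
    moreover have "\<phi> j 0 = 0" using dual_space_scale[OF \<phi>(1)[OF j] A_zero[OF j], of 0] by simp
    ultimately show False by simp
  qed
  with gA have g: "g t \<in> nonzero_families" for t by (auto simp: nonzero_families_def)
  have Tg: "T (g t) \<beta> = (\<Prod>j=1..n. \<beta> j (e j) + t * (if j \<in> J then \<beta> j (f j) else 0))"
    if "\<beta> \<in> dual_families" for \<beta> t
    unfolding tensor_apply[OF that]
    by (intro prod.cong) (auto simp: g_apply dual_familiesD[OF that])
  have curve_e: "curve_in (segre s A n) (\<lambda>_. fct.span {T e})"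
    unfolding curve_in_def segre_eq
    by (intro exI[of _ 1] exI[of _ "\<lambda>_. T e"] conjI) (use e tensor_nonzero in auto)
  have holo: "(\<lambda>t. T (g t) \<beta>) holomorphic_on S" for \<beta> S
  proof (cases "\<beta> \<in> dual_families")
    case True
    show ?thesis unfolding Tg[OF True] by (intro holomorphic_intros)
  qed (simp add: tensor_outside)
  have curve_g: "curve_in (segre s A n) (\<lambda>t. fct.span {T (g t)})"
    unfolding curve_in_def segre_eq
    by (intro exI[of _ 1] exI[of _ "\<lambda>t. T (g t)"] conjI) (use g tensor_nonzero holo in auto)
  \<comment> \<open>For \<open>t \<noteq> 0\<close> the difference quotient spans with
    \<open>T e\<close> the same plane as \<open>T (g t)\<close> does, and it has a limit independent
    of \<open>T e\<close>.\<close>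
  define w where "w t = cscale (1 / t) (T (g t) - T e)" for t
  have w_lim: "(w \<longlongrightarrow> x) (at 0)"
  proof (rule tendsto_applyI)
    fix \<beta>
    show "((\<lambda>t. w t \<beta>) \<longlongrightarrow> x \<beta>) (at 0)"
    proof (cases "\<beta> \<in> dual_families")
      case True
      let ?q = "\<lambda>j. if j \<in> J then \<beta> j (f j) else 0"
      have "((\<lambda>t. T (g t) \<beta>) has_field_derivative
        (\<Sum>j=1..n. ?q j * (\<Prod>i\<in>{1..n}-{j}. \<beta> i (e i) + 0 * ?q i))) (at 0)"
        unfolding Tg[OF True]
        by (rule has_field_derivative_prod) (auto intro!: derivative_eq_intros)
      also have "(\<Sum>j=1..n. ?q j * (\<Prod>i\<in>{1..n}-{j}. \<beta> i (e i) + 0 * ?q i)) =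
          (\<Sum>j\<in>J. ?q j * (\<Prod>i\<in>{1..n}-{j}. \<beta> i (e i) + 0 * ?q i))"
        using J by (intro sum.mono_neutral_right) auto
      also have "\<dots> = x \<beta>"
        unfolding x_apply using J by (intro sum.cong) (auto simp: tensor_apply_upd[OF True])
      finally have "((\<lambda>t. T (g t) \<beta>) has_field_derivative x \<beta>) (at 0)" .
      moreover have "T (g 0) \<beta> = T e \<beta>" unfolding Tg[OF True] by (simp add: tensor_apply[OF True])
      ultimately have "((\<lambda>t. (T (g t) \<beta> - T e \<beta>) / t) \<longlongrightarrow> x \<beta>) (at 0)"
        by (simp add: DERIV_def)
      then show ?thesis by (simp add: w_def cscale_def)
    next
      case False
      then show ?thesis by (simp add: w_def cscale_def x_apply tensor_outside)
    qed
  qed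
  have span_eq: "fct.span (fct.span {T e} \<union> fct.span {T (g t)}) = fct.span {T e, w t}" if "t \<noteq> 0" for t
  proof -
    have "fct.span (fct.span {T e} \<union> fct.span {T (g t)}) = fct.span {T e, T (g t)}"
      by (simp add: fct_span_span_Un insert_commute)
    also have "\<dots> = fct.span {T e, w t}"
    proof
      have "T (g t) = cscale 1 (T e) + cscale t (w t)"
        using that by (simp add: w_def cscale_def fun_eq_iff)
      then have "T (g t) \<in> fct.span {T e, w t}" using in_fct_span_pair by blast
      then show "fct.span {T e, T (g t)} \<subseteq> fct.span {T e, w t}"
        by (intro fct.span_minimal fct.subspace_span) (auto intro: fct.span_base)
      have "w t = cscale (- 1 / t) (T e) + cscale (1 / t) (T (g t))"
        by (simp add: w_def cscale_def fun_eq_iff diff_divide_distrib)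
      then have "w t \<in> fct.span {T e, T (g t)}" using in_fct_span_pair by blast
      then show "fct.span {T e, w t} \<subseteq> fct.span {T e, T (g t)}"
        by (intro fct.span_minimal fct.subspace_span) (auto intro: fct.span_base)
    qed
    finally show ?thesis .
  qed
  \<comment> \<open>This makes the limit plane two-dimensional, as \<open>plane_tendsto\<close>
    demands: at \<open>\<phi>\<close> the values of \<open>T e\<close> and \<open>x\<close> are 1
    and 0.\<close>
  have "T e \<notin> fct.span {x}"
  proof
    assume "T e \<in> fct.span {x}"
    then obtain c where "T e = cscale c x" by (auto simp: fct.span_singleton)
    then have "T e \<phi> = c * x \<phi>" by (simp add: cscale_def)
    with Te x show False by simp
  qed
  then have "fct.independent {T e, x}" "T e \<noteq> x"
    using x0 fct.span_base[of x "{x}"] by (auto simp: fct.independent_insert)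
  then have dim: "fct.dim (fct.span {T e, x}) = 2"
    using fct.dim_span_eq_card_independent by fastforce
  have "plane_tendsto (\<lambda>t. fct.span (fct.span {T e} \<union> fct.span {T (g t)})) (fct.span {T e, x}) (at 0)"
    unfolding plane_tendsto_def
  proof (intro exI conjI)
    show "eventually (\<lambda>t. fct.span (fct.span {T e} \<union> fct.span {T (g t)}) = fct.span {T e, w t}) (at 0)"
      unfolding eventually_at_filter by (simp add: span_eq)
  qed (use w_lim dim in auto)
  moreover have "fct.span {x} \<subseteq> fct.span {T e, x}" by (intro fct.span_mono) auto
  moreover have "x \<in> tensor_space s A n"
    unfolding tensor_space_def x_def using J f A
    by (intro fct.span_sum fct.span_base tensor_in_decomposable families_upd nonzero_families_subset[OF e]) auto
  then have "fct.span {x} \<in> proj_space (tensor_space s A n)"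
    unfolding proj_space_def using x0 by blast
  ultimately show "x \<in> affine_cone (secant_variety (tensor_space s A n) (segre s A n))"
    unfolding affine_cone_def secant_variety_def using curve_e curve_g by blast
qed

text \<open>As \<open>dim V\<close> exceeds 1, \<open>V\<close> is contained neither in the zero
  space nor in a line.\<close>

lemma independent_pair_exists:
  assumes "dim V \<ge> 2"
  shows "\<exists>e f. e \<in> V \<and> f \<in> V \<and> e \<noteq> 0 \<and> f \<notin> span {e}"
proof -
  have "\<not> V \<subseteq> span {}" using dim_le_card[of V "{}"] assms by auto
  then obtain e where e: "e \<in> V" "e \<noteq> 0" by auto
  have "\<not> V \<subseteq> span {e}" using dim_le_card[of V "{e}"] assms by auto
  with e show ?thesis by blast
qed

lemma on_secant_line_of_sum:
  assumes "a \<in> nonzero_families" "b \<in> nonzero_families" "fct.span {T a} \<noteq> fct.span {T b}"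
  shows "on_secant_line (segre s A n) (fct.span {T a + T b})"
proof -
  have "T a + T b \<in> fct.span (fct.span {T a} \<union> fct.span {T b})"
    by (intro fct.span_add fct.span_base UnI1 UnI2) (auto intro: fct.span_base)
  then have "fct.span {T a + T b} \<subseteq> fct.span (fct.span {T a} \<union> fct.span {T b})"
    by (intro fct.span_minimal fct.subspace_span) auto
  with assms show ?thesis unfolding on_secant_line_def segre_eq by blast
qed

end

theorem proposition1p1:
  fixes s :: "complex \<Rightarrow> 'v::ab_group_add \<Rightarrow> 'v"
    and A :: "nat \<Rightarrow> 'v set"
    and n :: nat
  assumes "vector_space s"
    and "n \<ge> 1"
    and "\<And>j. j \<in> {1..n} \<Longrightarrow> module.subspace s (A j)"
    and "\<And>j. j \<in> {1..n} \<Longrightarrow> \<exists>B. finite B \<and> A j = module.span s B"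
    and "\<And>j. j \<in> {1..n} \<Longrightarrow> vector_space.dim s (A j) \<ge> 2"
  defines "X \<equiv> segre s A n"
  defines "C \<equiv> affine_cone (secant_variety (tensor_space s A n) X)"
  shows "(\<forall>x\<in>C. x \<noteq> 0 \<longrightarrow>
            normal_form_a s A n x \<or> normal_form_b s A n x \<or> (\<exists>J. normal_form_c s A n J x))
    \<and> (\<forall>x. normal_form_a s A n x \<longrightarrow> fct.span {x} \<in> X \<and> tensor_rank s A n x = 1)
    \<and> (\<forall>x. normal_form_b s A n x \<longrightarrow> on_secant_line X (fct.span {x}) \<and> tensor_rank s A n x = 2)
    \<and> (\<forall>J x. normal_form_c s A n J x \<longrightarrow> tensor_rank s A n x = card J)
    \<and> (\<forall>r\<in>{1..n}. \<exists>x\<in>C. x \<noteq> 0 \<and> tensor_rank s A n x = r)"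
proof -
  interpret vector_space s by fact
  interpret tensor_factors s A n by unfold_locales (use assms(2-4) in auto)
  have c: "tensor_rank s A n x = card J" if "normal_form_c s A n J x" for J x
  proof -
    from that[unfolded normal_form_c_def] obtain a1 a2 where J: "J \<subseteq> {1..n}"
      and a: "\<forall>j\<in>{1..n}. a1 j \<in> A j \<and> a1 j \<noteq> 0 \<and> a2 j \<in> A j \<and> a2 j \<noteq> 0"
      and ind: "\<forall>j\<in>J. a2 j \<notin> span {a1 j}" and x: "x = (\<Sum>j\<in>J. T (a1(j := a2 j)))"
      by (elim exE conjE)
    show ?thesis
      unfolding x by (rule tangent_sum_rank) (use a J ind in \<open>auto simp: nonzero_families_def\<close>)
  qed
  have ranks: "\<exists>x\<in>C. x \<noteq> 0 \<and> tensor_rank s A n x = r" if r: "r \<in> {1..n}" for r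
  proof -
    have "\<forall>j\<in>{1..n}. \<exists>e f. e \<in> A j \<and> f \<in> A j \<and> e \<noteq> 0 \<and> f \<notin> span {e}"
      using independent_pair_exists assms(5) by blast
    then obtain e f where ef: "\<And>j. j \<in> {1..n} \<Longrightarrow> e j \<in> A j \<and> f j \<in> A j \<and> e j \<noteq> 0 \<and> f j \<notin> span {e j}"
      by metis
    then have fam: "e \<in> nonzero_families" "f \<in> families"
      by (auto simp: nonzero_families_def families_def)
    \<comment> \<open>The tangent sum over the first \<open>r\<close> slots has rank
      \<open>r\<close>, also for \<open>r = 1\<close> and \<open>r = 2\<close>.\<close>
    have J: "{1..r} \<subseteq> {1..n}" "{1..r} \<noteq> {}" using r by auto
    have "tensor_rank s A n (\<Sum>j\<in>{1..r}. T (e(j := f j))) = card {1..r}"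
      by (rule tangent_sum_rank[OF fam(1) J(1)]) (use ef J(1) in blast)+
    then show ?thesis
      using tangent_sum_in_secant_variety[OF fam _ J] ef unfolding C_def X_def by auto
  qed
  have a: "fct.span {x} \<in> X \<and> tensor_rank s A n x = 1" if "normal_form_a s A n x" for x
    using that rank_normal_form_a by (auto simp: normal_form_a_iff X_def segre_eq)
  have b: "on_secant_line X (fct.span {x}) \<and> tensor_rank s A n x = 2" if nf: "normal_form_b s A n x" for x
  proof -
    obtain a b where ab: "a \<in> nonzero_families" "b \<in> nonzero_families"
      "2 \<le> card {i\<in>{1..n}. b i \<notin> span {a i}}" and x: "x = T a + T b"
      using nf unfolding normal_form_b_iff by blast
    show ?thesis
      unfolding x X_def
      using rank_normal_form_b[OF ab] on_secant_line_of_sum[OF ab(1,2)] by blast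
  qed
  have forms: "normal_form_a s A n x \<or> normal_form_b s A n x \<or> (\<exists>J. normal_form_c s A n J x)"
    if "x \<in> C" "x \<noteq> 0" for x
    using normal_form_of_secant_variety that unfolding C_def X_def by blast
  show ?thesis
    by (rule conjI, use forms in blast, rule conjI, use a in blast, rule conjI, use b in blast,
        rule conjI, use c in blast, use ranks in blast)
qed

end
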